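(* Let $B=\sigma_1^{p_1}\sigma_2^{-q_1}\cdots\sigma_1^{p_n}\sigma_2^{-q_n}$ be an alternating 3-braid, with $n\ge1$ and all $p_i,q_i$ positive integers, and let $P_{\widetilde G_D,c_1}(x_1,x_2,x_3,x_4)$ be the refined Crowell polynomial of its closure. Then $P_{\widetilde G_D,c_1}$ is not denormalized Lorentzian unless $n=1$, i.e. unless $B=\sigma_1^{p_1}\sigma_2^{-q_1}$ (in which case the closure is a connected sum of two torus links).
   Context: $\sigma_1,\sigma_2$ are the standard generators of the braid group on three strands. Put $P=\sum p_i$, $Q=\sum q_i$. Refined Crowell graph. Let $c_1,\dots,c_P$ be the crossings coming from letters $\sigma_1$ and $c'_1,\dots,c'_Q$ those coming from letters $\sigma_2^{-1}$, each listed in order of appearance in the braid word. $\widetilde G_D$ is the directed weighted graph (multi-edges and loops allowed) with vertex set $\{c_1,\dots,c_P,c'_1,\dots,c'_Q\}$ and the following edges: (a) the edges of the oriented cycle $c_P\to c_{P-1}\to\dots\to c_1\to c_P$, of weight $x_1$; (b) the edges of the oriented cycle $c'_Q\to c'_{Q-1}\to\dots\to c'_1\to c'_Q$, of weight $x_4$; (c) the edges of the oriented cycle visiting all $P+Q$ crossings in the cyclic order of the braid word; such an edge has weight $x_2$ if it ends at some $c'_k$ and weight $x_3$ if it ends at some $c_k$. The refined Crowell polynomial $P_{\widetilde G_D,c_1}$ is the sum over all spanning trees of $\widetilde G_D$ rooted at $c_1$ and oriented away from the root of the product of the weights of the edges of the tree. Lorentzian polynomials. A subset $J\subset\mathbb{N}^n$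 is M-convex if for all $\alpha,\beta\in J$ and $i$ with $\alpha_i>\beta_i$ there is $j$ with $\alpha_j<\beta_j$, $\alpha-e_i+e_j\in J$ and $\beta-e_j+e_i\in J$. Let $H_n^d$ be the real homogeneous polynomials of degree $d$ in $x_1,\dots,x_n$. $L_n^1$ is the set of linear forms with nonnegative coefficients; $L_n^2$ is the set of quadratic forms with nonnegative coefficients and M-convex support whose Hessian has at most one positive eigenvalue; for $d>2$, $L_n^d$ is the set of $f\in H_n^d$ with nonnegative coefficients and M-convex support such that $\partial_{i_1}\cdots\partial_{i_{d-2}}f\in L_n^2$ for all $i_1,\dots,i_{d-2}$. Let $N$ be the linear operator with $N(x^\alpha)=x^\alpha/\alpha!$, $\alpha!=\prod\alpha_i!$. $f\in H_n^d$ is denormalized Lorentzian if $N(f)\in L_n^d$. *)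

theory Defs
  imports
    "HOL-Library.Poly_Mapping"
    "Jordan_Normal_Form.Char_Poly"
    "Graph_Theory.Digraph_Component"
begin

section \<open>Lorentzian polynomials\<close>

text \<open>
  A monomial maps variable indices to exponents, and a real polynomial maps monomials to
  coefficients, so that \<open>+\<close>, \<open>*\<close>, \<open>\<Sum>\<close> and \<open>\<Prod>\<close> of type \<open>mpoly\<close> are the polynomial operations.
  The variables \<open>x\<^sub>1, \<dots>, x\<^sub>n\<close> have indices \<open>1, \<dots>, n\<close>.
\<close>

type_synonym monomial = "nat \<Rightarrow>\<^sub>0 nat"
type_synonym mpoly = "monomial \<Rightarrow>\<^sub>0 real"

abbreviation unit_exp :: "nat \<Rightarrow> monomial" where
  "unit_exp i \<equiv> Poly_Mapping.single i 1"

definition mvar :: "nat \<Rightarrow> mpoly" where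
  "mvar i = Poly_Mapping.single (unit_exp i) 1"

definition homogeneous :: "nat \<Rightarrow> nat \<Rightarrow> mpoly \<Rightarrow> bool" where
  "homogeneous n d f \<longleftrightarrow>
     (\<forall>m \<in> Poly_Mapping.keys f. Poly_Mapping.keys m \<subseteq> {1..n} \<and> (\<Sum>i = 1..n. Poly_Mapping.lookup m i) = d)"

definition nonneg_coeffs :: "mpoly \<Rightarrow> bool" where
  "nonneg_coeffs f \<longleftrightarrow> (\<forall>m. Poly_Mapping.lookup f m \<ge> 0)"

text \<open>
  The natural number subtractions below never truncate, since the coordinate that is lowered
  is positive.
\<close>

definition M_convex :: "nat \<Rightarrow> monomial set \<Rightarrow> bool" where
  "M_convex n J \<longleftrightarrow>
     (\<forall>\<alpha> \<in> J. \<forall>\<beta> \<in> J. \<forall>i \<in> {1..n}. Poly_Mapping.lookup \<alpha> i > Poly_Mapping.lookup \<beta> i \<longrightarrow>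
        (\<exists>j \<in> {1..n}. Poly_Mapping.lookup \<alpha> j < Poly_Mapping.lookup \<beta> j \<and>
           \<alpha> - unit_exp i + unit_exp j \<in> J \<and>
           \<beta> - unit_exp j + unit_exp i \<in> J))"

text \<open>
  Partial derivative with respect to \<open>x\<^sub>i\<close>; the truncated exponent arising when \<open>x\<^sub>i\<close> does not
  occur in \<open>m\<close> is harmless because the coefficient is then \<open>0\<close>.
\<close>

definition partial :: "nat \<Rightarrow> mpoly \<Rightarrow> mpoly" where
  "partial i f =
     (\<Sum>m \<in> Poly_Mapping.keys f.
        Poly_Mapping.single (m - unit_exp i) (real (Poly_Mapping.lookup m i) * Poly_Mapping.lookup f m))"

text \<open>
  The Hessian of a quadratic form is a constant matrix, so its entries are the constant
  coefficients of the second partial derivatives. Matrix indices start at \<open>0\<close>.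
\<close>

definition quadratic_hessian :: "nat \<Rightarrow> mpoly \<Rightarrow> real mat" where
  "quadratic_hessian n f =
     mat n n (\<lambda>(i, j). Poly_Mapping.lookup (partial (Suc i) (partial (Suc j) f)) 0)"

text \<open>Eigenvalues are counted with multiplicity.\<close>

definition at_most_one_pos_eigenvalue :: "real mat \<Rightarrow> bool" where
  "at_most_one_pos_eigenvalue A \<longleftrightarrow> size {# r \<in># proots (char_poly A). r > 0 #} \<le> 1"

definition lorentzian_quadratic :: "nat \<Rightarrow> mpoly \<Rightarrow> bool" where
  "lorentzian_quadratic n f \<longleftrightarrow>
     homogeneous n 2 f \<and> nonneg_coeffs f \<and> M_convex n (Poly_Mapping.keys f) \<and>
     at_most_one_pos_eigenvalue (quadratic_hessian n f)"

text \<open>In degree \<open>0\<close> we follow the usual convention that the members are the nonnegative constants.\<close>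

definition lorentzian :: "nat \<Rightarrow> nat \<Rightarrow> mpoly \<Rightarrow> bool" where
  "lorentzian n d f \<longleftrightarrow>
     (if d \<le> 1 then homogeneous n d f \<and> nonneg_coeffs f
      else if d = 2 then lorentzian_quadratic n f
      else homogeneous n d f \<and> nonneg_coeffs f \<and> M_convex n (Poly_Mapping.keys f) \<and>
           (\<forall>js. length js = d - 2 \<and> set js \<subseteq> {1..n} \<longrightarrow>
                 lorentzian_quadratic n (foldr partial js f)))"

definition normalization_op :: "mpoly \<Rightarrow> mpoly" where
  "normalization_op f =
     (\<Sum>m \<in> Poly_Mapping.keys f. Poly_Mapping.single m (Poly_Mapping.lookup f m / (\<Prod>i \<in> Poly_Mapping.keys m. fact (Poly_Mapping.lookup m i))))"

definition denormalized_lorentzian :: "nat \<Rightarrow> mpoly \<Rightarrow> bool" where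
  "denormalized_lorentzian n f \<longleftrightarrow>
     (\<exists>d. homogeneous n d f \<and> lorentzian n d (normalization_op f))"

section \<open>Spanning trees of directed multigraphs\<close>

text \<open>
  Rooted trees oriented away from the root: every vertex is the end of exactly one directed
  walk from the root. The library's \<^const>\<open>spanning_tree\<close> is not suitable here: it is meant for
  symmetric digraphs and only excludes directed cycles.
\<close>

definition out_tree :: "('a, 'b) pre_digraph \<Rightarrow> 'a \<Rightarrow> bool" where
  "out_tree T r \<longleftrightarrow>
     wf_digraph T \<and> r \<in> verts T \<and> (\<forall>v \<in> verts T. \<exists>!p. pre_digraph.awalk T r p v)"

definition spanning_out_trees :: "('a, 'b) pre_digraph \<Rightarrow> 'a \<Rightarrow> ('a, 'b) pre_digraph set" where
  "spanning_out_trees G r = {T. spanning T G \<and> out_tree T r}"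

definition tree_polynomial :: "('a, 'b) pre_digraph \<Rightarrow> ('b \<Rightarrow> mpoly) \<Rightarrow> 'a \<Rightarrow> mpoly" where
  "tree_polynomial G wt r = (\<Sum>T \<in> spanning_out_trees G r. \<Prod>e \<in> arcs T. wt e)"

section \<open>The refined Crowell graph\<close>

text \<open>The letters \<open>\<sigma>\<^sub>1\<close> and \<open>\<sigma>\<^sub>2\<^sup>-\<^sup>1\<close> of alternating words in the braid group on three strands.\<close>

datatype letter = Sigma1 | Sigma2_inv

definition alternating_word :: "nat \<Rightarrow> (nat \<Rightarrow> nat) \<Rightarrow> (nat \<Rightarrow> nat) \<Rightarrow> letter list" where
  "alternating_word n p q =
     concat (map (\<lambda>i. replicate (p i) Sigma1 @ replicate (q i) Sigma2_inv) [1..<Suc n])"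

text \<open>
  The crossing \<open>c\<^sub>k\<close> is \<open>(Sigma1, k)\<close> and \<open>c'\<^sub>k\<close> is \<open>(Sigma2_inv, k)\<close>, with \<open>k\<close> counted from \<open>1\<close>.
\<close>

type_synonym crossing = "letter \<times> nat"

definition crossing_at :: "letter list \<Rightarrow> nat \<Rightarrow> crossing" where
  "crossing_at w i = (w ! i, count_list (take (Suc i) w) (w ! i))"

text \<open>
  \<open>Level_edge (l, k)\<close> is the edge leaving \<open>(l, k)\<close> in the cycle through the crossings of letter
  \<open>l\<close>, and \<open>Word_edge i\<close> is the edge leaving the crossing at position \<open>i\<close> (counted from \<open>0\<close>) in the
  cycle through all crossings. Edges are labelled so that parallel edges stay distinct.
\<close>

datatype crowell_edge = Level_edge crossing | Word_edge nat

definition crossings :: "letter list \<Rightarrow> crossing set" where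
  "crossings w = {(l, k). 1 \<le> k \<and> k \<le> count_list w l}"

fun crowell_tail :: "letter list \<Rightarrow> crowell_edge \<Rightarrow> crossing" where
  "crowell_tail w (Level_edge c) = c"
| "crowell_tail w (Word_edge i) = crossing_at w i"

fun crowell_head :: "letter list \<Rightarrow> crowell_edge \<Rightarrow> crossing" where
  "crowell_head w (Level_edge (l, k)) = (l, if k = 1 then count_list w l else k - 1)"
| "crowell_head w (Word_edge i) = crossing_at w (Suc i mod length w)"

definition crowell_graph :: "letter list \<Rightarrow> (crossing, crowell_edge) pre_digraph" where
  "crowell_graph w =
     \<lparr> verts = crossings w,
       arcs = Level_edge ` crossings w \<union> Word_edge ` {..<length w},
       tail = crowell_tail w,
       head = crowell_head w \<rparr>"

fun crowell_weight :: "letter list \<Rightarrow> crowell_edge \<Rightarrow> mpoly" where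
  "crowell_weight w (Level_edge (l, k)) = (case l of Sigma1 \<Rightarrow> mvar 1 | Sigma2_inv \<Rightarrow> mvar 4)"
| "crowell_weight w (Word_edge i) =
     (case fst (crowell_head w (Word_edge i)) of Sigma2_inv \<Rightarrow> mvar 2 | Sigma1 \<Rightarrow> mvar 3)"

definition refined_crowell_poly :: "letter list \<Rightarrow> mpoly" where
  "refined_crowell_poly w = tree_polynomial (crowell_graph w) (crowell_weight w) (Sigma1, 1)"

end

theory Submission
  imports Defs
begin

text \<open>
  Every vertex of \<open>c\<^sub>2, \<dots>, c\<^sub>P\<close> is entered in a spanning tree by one edge of weight \<open>x\<^sub>1\<close> or \<open>x\<^sub>3\<close>,
  every \<open>c'\<^sub>k\<close> by one edge of weight \<open>x\<^sub>2\<close> or \<open>x\<^sub>4\<close>, so with \<open>A = P - 1\<close> and \<open>B = Q\<close> the polynomial is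
  \<open>\<Sum> a i j x\<^sub>1\<^sup>A\<^sup>-\<^sup>i x\<^sub>3\<^sup>i x\<^sub>2\<^sup>j x\<^sub>4\<^sup>B\<^sup>-\<^sup>j\<close>. A quadratic derivative of its normalization that is bilinear in
  \<open>(x\<^sub>1, x\<^sub>3)\<close> and \<open>(x\<^sub>2, x\<^sub>4)\<close> has a Hessian that is, up to reordering, block antidiagonal with blocks
  \<open>M\<close> and \<open>M\<^sup>T\<close>. Its eigenvalues are plus or minus the singular values of \<open>M\<close>, so at most one
  of them is positive only if \<open>det M = 0\<close>; the entries of \<open>M\<close> are adjacent entries of the coefficient matrix.
  M-convexity of the support excludes zeros of \<open>a\<close> between two nonzero corners, so the corner minor
  \<open>a 0 1 a A B - a A 1 a 0 B\<close> vanishes as well. But \<open>a A 1 = a 0 B = a A B = 1\<close>, while \<open>a 0 1 \<ge> 2\<close>: the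
  single edge that enters the level of \<open>\<sigma>\<^sub>2\<^sup>-\<^sup>1\<close> may start at the end of any of the \<open>n\<close> blocks of \<open>\<sigma>\<^sub>1\<close>.
\<close>

section \<open>Bihomogeneous denormalized Lorentzian polynomials\<close>

definition mono_fact :: "monomial \<Rightarrow> real" where
  "mono_fact m = (\<Prod>i \<in> Poly_Mapping.keys m. fact (Poly_Mapping.lookup m i))"

lemma mono_fact_pos: "mono_fact m > 0"
  by (simp add: mono_fact_def prod_pos)

lemma mono_fact_zero [simp]: "mono_fact 0 = 1"
  by (simp add: mono_fact_def)

lemma mono_fact_superset:
  assumes "finite S" "Poly_Mapping.keys m \<subseteq> S"
  shows "mono_fact m = (\<Prod>i \<in> S. fact (Poly_Mapping.lookup m i))"
  unfolding mono_fact_def using assms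
  by (intro prod.mono_neutral_left) (auto simp: in_keys_iff)

lemma mono_fact_add_unit_exp:
  "mono_fact (m + unit_exp i) = real (Suc (Poly_Mapping.lookup m i)) * mono_fact m"
proof -
  let ?S = "insert i (Poly_Mapping.keys m)"
  have sub: "Poly_Mapping.keys (m + unit_exp i) \<subseteq> ?S"
    by (auto simp: in_keys_iff lookup_add lookup_single when_def split: if_splits)
  have "mono_fact (m + unit_exp i) = (\<Prod>k\<in>?S. fact (Poly_Mapping.lookup (m + unit_exp i) k))"
    using sub by (intro mono_fact_superset) auto
  also have "\<dots> = (\<Prod>k\<in>?S. (if k = i then real (Suc (Poly_Mapping.lookup m i)) else 1)
      * fact (Poly_Mapping.lookup m k))"
    by (intro prod.cong) (auto simp: lookup_add lookup_single)
  also have "\<dots> = real (Suc (Poly_Mapping.lookup m i)) * (\<Prod>k\<in>?S. fact (Poly_Mapping.lookup m k))"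
    by (simp only: prod.distrib prod.delta finite_insert finite_keys) simp
  also have "(\<Prod>k\<in>?S. fact (Poly_Mapping.lookup m k)) = mono_fact m"
    by (intro mono_fact_superset[symmetric]) auto
  finally show ?thesis .
qed

text \<open>Truncated subtraction fixes every monomial in which \<open>x\<^sub>i\<close> does not
  occur, so several monomials of \<open>f\<close> may be sent to \<open>m\<close>. The factor
  \<open>lookup m' i\<close> kills all of them except \<open>m + unit_exp i\<close>.\<close>

lemma lookup_partial:
  "Poly_Mapping.lookup (partial i f) m
     = real (Suc (Poly_Mapping.lookup m i)) * Poly_Mapping.lookup f (m + unit_exp i)"
proof -
  let ?m = "m + unit_exp i"
  have eq: "m' = ?m" if "m' - unit_exp i = m" "Poly_Mapping.lookup m' i \<noteq> 0" for m'
  proof (rule poly_mapping_eqI)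
    fix k
    show "Poly_Mapping.lookup m' k = Poly_Mapping.lookup ?m k"
      using that by (auto simp: lookup_add lookup_minus lookup_single when_def)
  qed
  have "Poly_Mapping.lookup (partial i f) m = (\<Sum>m' \<in> Poly_Mapping.keys f.
      (real (Poly_Mapping.lookup m' i) * Poly_Mapping.lookup f m' when m' - unit_exp i = m))"
    by (simp add: partial_def lookup_sum lookup_single)
  also have "\<dots> = (\<Sum>m' \<in> Poly_Mapping.keys f. if m' = ?m then
      real (Poly_Mapping.lookup ?m i) * Poly_Mapping.lookup f ?m else 0)"
    by (intro sum.cong refl) (use eq in \<open>fastforce simp: when_def\<close>)
  also have "\<dots> = real (Suc (Poly_Mapping.lookup m i)) * Poly_Mapping.lookup f ?m"
    by (simp add: sum.delta in_keys_iff lookup_add)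
  finally show ?thesis .
qed

lemma lookup_normalization_op:
  "Poly_Mapping.lookup (normalization_op f) m = Poly_Mapping.lookup f m / mono_fact m"
proof -
  have "Poly_Mapping.lookup (normalization_op f) m
      = (\<Sum>m' \<in> Poly_Mapping.keys f. if m' = m then Poly_Mapping.lookup f m / mono_fact m else 0)"
    unfolding normalization_op_def mono_fact_def lookup_sum lookup_single
    by (intro sum.cong refl) (auto simp: when_def)
  also have "\<dots> = Poly_Mapping.lookup f m / mono_fact m"
    by (simp add: sum.delta in_keys_iff)
  finally show ?thesis .
qed

lemma keys_normalization_op: "Poly_Mapping.keys (normalization_op f) = Poly_Mapping.keys f"
proof (rule Set.set_eqI)
  fix m :: monomial
  show "m \<in> Poly_Mapping.keys (normalization_op f) \<longleftrightarrow> m \<in> Poly_Mapping.keys f"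
    using mono_fact_pos[of m] by (simp add: in_keys_iff lookup_normalization_op)
qed

text \<open>Normalization absorbs the factorials that differentiation produces.\<close>

lemma lookup_foldr_partial_normalization_op:
  "Poly_Mapping.lookup (foldr partial js (normalization_op f)) m
     = Poly_Mapping.lookup f (m + (\<Sum>j\<leftarrow>js. unit_exp j)) / mono_fact m"
proof (induction js arbitrary: m)
  case Nil
  then show ?case by (simp add: lookup_normalization_op)
next
  case (Cons j js)
  then show ?case
    using mono_fact_pos[of m]
    by (simp add: lookup_partial mono_fact_add_unit_exp add.assoc del: of_nat_Suc One_nat_def)
qed

text \<open>The two derivatives of the Hessian simply join the list \<open>js\<close>, and
  \<open>mono_fact 0 = 1\<close>. So the entries are coefficients of \<open>f\<close> itself, with
  no factor 2 even on the diagonal.\<close>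

lemma quadratic_hessian_foldr_partial:
  assumes "i < n" "j < n"
  shows "quadratic_hessian n (foldr partial js (normalization_op f)) $$ (i, j)
    = Poly_Mapping.lookup f (unit_exp (Suc i) + unit_exp (Suc j) + (\<Sum>k\<leftarrow>js. unit_exp k))"
proof -
  have "quadratic_hessian n (foldr partial js (normalization_op f)) $$ (i, j)
     = Poly_Mapping.lookup (foldr partial (Suc i # Suc j # js) (normalization_op f)) 0"
    using assms by (simp add: quadratic_hessian_def)
  then show ?thesis
    by (simp only: lookup_foldr_partial_normalization_op) (simp add: add.assoc)
qed

section \<open>Symmetric 4 by 4 matrices that vanish at index pairs of even sum\<close>

text \<open>Expansion along the first column. The minors are again of the form
  \<open>mat n n\<close>, so the equation can be iterated as a rewrite rule until the size is
  0.\<close>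

lemma det_mat_Suc:
  fixes g :: "nat \<times> nat \<Rightarrow> 'a :: comm_ring_1"
  shows "det (mat (Suc n) (Suc n) g) = (\<Sum>i<Suc n. g (i, 0) *
    ((-1) ^ i * det (mat n n (\<lambda>(k, l). g (if k < i then k else Suc k, Suc l)))))"
proof -
  let ?A = "mat (Suc n) (Suc n) g"
  have "det ?A = (\<Sum>i<Suc n. ?A $$ (i, 0) * cofactor ?A i 0)"
    by (rule laplace_expansion_column) auto
  also have "\<dots> = (\<Sum>i<Suc n. g (i, 0) *
    ((-1) ^ i * det (mat n n (\<lambda>(k, l). g (if k < i then k else Suc k, Suc l)))))"
  proof (intro sum.cong refl)
    fix i assume "i \<in> {..<Suc n}"
    then have "mat_delete ?A i 0 = mat n n (\<lambda>(k, l). g (if k < i then k else Suc k, Suc l))"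
      by (intro eq_matI) (auto simp: mat_delete_def)
    then show "?A $$ (i, 0) * cofactor ?A i 0 = g (i, 0) *
      ((-1) ^ i * det (mat n n (\<lambda>(k, l). g (if k < i then k else Suc k, Suc l))))"
      using \<open>i \<in> {..<Suc n}\<close> by (simp add: cofactor_def)
  qed
  finally show ?thesis .
qed

text \<open>With the even indices listed before the odd ones, \<open>H\<close> has zero diagonal
  blocks and off-diagonal blocks \<open>M\<close> and its transpose, where \<open>M\<close> has rows
  \<open>H(0,1), H(0,3)\<close> and \<open>H(2,1), H(2,3)\<close>. The constant term is the square
  of \<open>det M\<close>, the quadratic coefficient minus the trace of \<open>M\<close> times its
  transpose.\<close>

lemma char_poly_symmetric_bipartite:
  fixes H :: "real mat"
  assumes H: "H \<in> carrier_mat 4 4"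
    and z: "\<And>i j. i < 4 \<Longrightarrow> j < 4 \<Longrightarrow> even (i + j) \<Longrightarrow> H $$ (i, j) = 0"
    and sym: "\<And>i j. i < 4 \<Longrightarrow> j < 4 \<Longrightarrow> H $$ (i, j) = H $$ (j, i)"
  shows "char_poly H = [:(H $$ (0,3) * H $$ (2,1) - H $$ (0,1) * H $$ (2,3))\<^sup>2, 0,
      - ((H $$ (0,1))\<^sup>2 + (H $$ (0,3))\<^sup>2 + (H $$ (2,1))\<^sup>2 + (H $$ (2,3))\<^sup>2), 0, 1:]"
proof -
  have "char_poly_matrix H = mat 4 4 (\<lambda>(i, j). [: - (H $$ (i, j)), of_bool (i = j) :])"
    using H by (intro eq_matI) (auto simp: char_poly_matrix_def)
  then have eq: "char_poly H = det (mat (Suc (Suc (Suc (Suc 0)))) (Suc (Suc (Suc (Suc 0))))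
      (\<lambda>(i, j). [: - (H $$ (i, j)), of_bool (i = j) :]))"
    by (simp add: char_poly_def numeral_eq_Suc)
  \<comment> \<open>Symmetry is oriented from odd rows to even rows, so that rewriting terminates
    and leaves only the four entries of \<open>M\<close>.\<close>
  have s: "H $$ (Suc 0, 0) = H $$ (0, Suc 0)"
    "H $$ (Suc (Suc (Suc 0)), 0) = H $$ (0, Suc (Suc (Suc 0)))"
    "H $$ (Suc 0, Suc (Suc 0)) = H $$ (Suc (Suc 0), Suc 0)"
    "H $$ (Suc (Suc (Suc 0)), Suc (Suc 0)) = H $$ (Suc (Suc 0), Suc (Suc (Suc 0)))"
    by (rule sym; simp)+
  have zs: "H $$ (0, 0) = 0" "H $$ (Suc 0, Suc 0) = 0" "H $$ (Suc (Suc 0), Suc (Suc 0)) = 0"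
    "H $$ (Suc (Suc (Suc 0)), Suc (Suc (Suc 0))) = 0"
    "H $$ (0, Suc (Suc 0)) = 0" "H $$ (Suc (Suc 0), 0) = 0"
    "H $$ (Suc 0, Suc (Suc (Suc 0))) = 0" "H $$ (Suc (Suc (Suc 0)), Suc 0) = 0"
    by (rule z; simp)+
  show ?thesis
    unfolding eq
    by (simp add: det_mat_Suc lessThan_Suc s zs numeral_eq_Suc algebra_simps power2_eq_square)
qed

text \<open>If \<open>t\<close>, which is \<open>det M\<close> up to sign, were nonzero, both
  singular values \<open>u\<close> and \<open>v\<close> of \<open>M\<close> would be positive and
  would be two positive roots of the characteristic polynomial. They are written down by radicals,
  and the polynomial is factored with them.\<close>

lemma bipartite_hessian_singular:
  fixes H :: "real mat"
  assumes H: "H \<in> carrier_mat 4 4"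
    and z: "\<And>i j. i < 4 \<Longrightarrow> j < 4 \<Longrightarrow> even (i + j) \<Longrightarrow> H $$ (i, j) = 0"
    and sym: "\<And>i j. i < 4 \<Longrightarrow> j < 4 \<Longrightarrow> H $$ (i, j) = H $$ (j, i)"
    and pos: "at_most_one_pos_eigenvalue H"
  shows "H $$ (0,3) * H $$ (2,1) = H $$ (0,1) * H $$ (2,3)"
proof (rule ccontr)
  define a b c d where "a = H $$ (0,3)" "b = H $$ (2,1)" "c = H $$ (0,1)" "d = H $$ (2,3)"
  define s t where "s = a\<^sup>2 + b\<^sup>2 + c\<^sup>2 + d\<^sup>2" "t = a * b - c * d"
  assume "\<not> ?thesis"
  then have t: "t \<noteq> 0"
    by (simp add: a_b_c_d_def s_t_def)
  \<comment> \<open>These sums of squares make the radicands nonnegative.\<close>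
  have "s + 2 * t = (a + b)\<^sup>2 + (c - d)\<^sup>2" "s - 2 * t = (a - b)\<^sup>2 + (c + d)\<^sup>2"
    by (simp_all add: s_t_def power2_eq_square algebra_simps)
  then have st: "s + 2 * t \<ge> 0" "s - 2 * t \<ge> 0"
    by simp_all
  define x y where "x = sqrt (s + 2 * t)" "y = sqrt (s - 2 * t)"
  have xy: "x\<^sup>2 = s + 2 * t" "y\<^sup>2 = s - 2 * t" "x \<ge> 0" "y \<ge> 0"
    using st by (simp_all add: x_y_def)
  have ne: "\<bar>x\<bar> \<noteq> \<bar>y\<bar>"
    using xy t by (metis add_diff_cancel_left' diff_add_cancel power2_abs mult_eq_0_iff zero_neq_numeral add_left_cancel diff_conv_add_uminus eq_neg_iff_add_eq_0 mult_2 double_eq_0_iff)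
  \<comment> \<open>The singular values satisfy \<open>(u + v)^2 = s + 2 * \<bar>t\<bar>\<close> and
    \<open>(u - v)^2 = s - 2 * \<bar>t\<bar>\<close>. So \<open>x\<close> and \<open>y\<close> are
    \<open>u + v\<close> and \<open>u - v\<close> in an order that depends on the sign of
    \<open>t\<close>; the absolute value in \<open>v\<close> covers both signs.\<close>
  define u v where "u = (x + y) / 2" "v = \<bar>x - y\<bar> / 2"
  have uv: "u > 0" "v > 0"
    using xy ne by (auto simp: u_v_def)
  have x2: "x * x = s + 2 * t" and y2: "y * y = s - 2 * t"
    using xy by (simp_all add: power2_eq_square)
  have "u * u + v * v = s" 
  proof -
    have "u * u + v * v = (x * x + y * y) / 2"
      by (simp add: u_v_def abs_if field_simps)
    then show ?thesis using x2 y2 by simp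
  qed
  moreover have "(u * v)\<^sup>2 = t\<^sup>2"
  proof -
    have "(u * v)\<^sup>2 = ((x * x - y * y) / 4)\<^sup>2"
      by (simp add: u_v_def abs_if field_simps power2_eq_square)
    then show ?thesis using x2 y2 by simp
  qed
  moreover have cp: "char_poly H = [:t\<^sup>2, 0, - s, 0, 1:]"
    unfolding s_t_def a_b_c_d_def using char_poly_symmetric_bipartite[OF H z sym]
    by (simp add: algebra_simps)
  ultimately have "char_poly H = [:-u, 1:] * ([:u, 1:] * ([:-v, 1:] * [:v, 1:]))"
    by (simp add: cp algebra_simps power2_eq_square)
  then have "proots (char_poly H) = {#u#} + ({#-u#} + ({#v#} + {#-v#}))"
    by (simp add: proots_mult del: mult_pCons_left mult_pCons_right)
  then show False
    using pos uv by (simp add: at_most_one_pos_eigenvalue_def)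
qed


section \<open>From adjacent minors to the corner minor\<close>

text \<open>Nonzero entries can be cancelled. So the adjacent minors chain along two neighbouring
  rows to the minors on columns \<open>j0\<close> and \<open>j\<close>, and these chain downwards to
  the minors on rows \<open>i0\<close> and \<open>i\<close>. A zero inside the rectangle would break
  the chain.\<close>

lemma adjacent_minors_imp_corner_minor:
  fixes a :: "nat \<Rightarrow> nat \<Rightarrow> real"
  assumes nz: "\<And>i j. i \<in> {i0..i1} \<Longrightarrow> j \<in> {j0..j1} \<Longrightarrow> a i j \<noteq> 0"
    and minor: "\<And>i j. i \<in> {i0..<i1} \<Longrightarrow> j \<in> {j0..<j1} \<Longrightarrow>
      a i j * a (Suc i) (Suc j) = a (Suc i) j * a i (Suc j)"
    and le: "i0 \<le> i1" "j0 \<le> j1"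
  shows "a i0 j0 * a i1 j1 = a i1 j0 * a i0 j1"
proof -
  have row: "a i j0 * a (Suc i) j = a (Suc i) j0 * a i j" if i: "i \<in> {i0..<i1}" and j: "j0 \<le> j" "j \<le> j1" for i j
    using j
  proof (induction j rule: dec_induct)
    case (step j)
    have n: "a i j \<noteq> 0"
      using nz i step by auto
    have "a i j * (a i j0 * a (Suc i) (Suc j)) = a i j0 * (a i j * a (Suc i) (Suc j))"
      by simp
    also have "\<dots> = a i j0 * a (Suc i) j * a i (Suc j)"
      using minor[OF i, of j] step by simp
    also have "\<dots> = a i j * (a (Suc i) j0 * a i (Suc j))"
      using step by simp
    finally show ?case using n by simp
  qed simp
  have "a i0 j0 * a i j1 = a i j0 * a i0 j1" if "i0 \<le> i" "i \<le> i1" for i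
    using that
  proof (induction i rule: dec_induct)
    case (step i)
    have n: "a i j0 \<noteq> 0"
      using nz[of i j0] step le by auto
    have "a i j0 * (a i0 j0 * a (Suc i) j1) = a i0 j0 * (a i j0 * a (Suc i) j1)"
      by simp
    also have "\<dots> = a (Suc i) j0 * (a i0 j0 * a i j1)"
      using row[of i j1] step le by simp
    also have "\<dots> = a i j0 * (a (Suc i) j0 * a i0 j1)"
      using step by simp
    finally show ?case using n by simp
  qed simp
  with le show ?thesis by blast
qed

section \<open>Polynomials of bidegree (A, B) and exchange inside their support\<close>

text \<open>For \<open>i > A\<close> or \<open>j > B\<close> truncation leaves a monomial of the
  wrong bidegree. Membership in a bihomogeneous support therefore already bounds the
  indices.\<close>

definition bimonomial :: "nat \<Rightarrow> nat \<Rightarrow> nat \<Rightarrow> nat \<Rightarrow> monomial" where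
  "bimonomial A B i j = Poly_Mapping.single 1 (A - i) + Poly_Mapping.single 2 j
     + Poly_Mapping.single 3 i + Poly_Mapping.single 4 (B - j)"

lemma lookup_bimonomial [simp]:
  "Poly_Mapping.lookup (bimonomial A B i j) 1 = A - i"
  "Poly_Mapping.lookup (bimonomial A B i j) (Suc 0) = A - i"
  "Poly_Mapping.lookup (bimonomial A B i j) 2 = j"
  "Poly_Mapping.lookup (bimonomial A B i j) 3 = i"
  "Poly_Mapping.lookup (bimonomial A B i j) 4 = B - j"
  by (simp_all add: bimonomial_def lookup_add lookup_single)

lemma atLeastAtMost_1_4: "{1..4::nat} = {1, 2, 3, 4}"
  by auto

lemma sum_list_replicate_unit_exp:
  "(\<Sum>k\<leftarrow>replicate c i. unit_exp k) = Poly_Mapping.single i c"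
  by (induction c) (auto simp flip: single_add)

definition bihomogeneous :: "nat \<Rightarrow> nat \<Rightarrow> mpoly \<Rightarrow> bool" where
  "bihomogeneous A B f \<longleftrightarrow> (\<forall>m \<in> Poly_Mapping.keys f.
     Poly_Mapping.lookup m 1 + Poly_Mapping.lookup m 3 = A \<and>
     Poly_Mapping.lookup m 2 + Poly_Mapping.lookup m 4 = B)"

lemma bihomogeneous_lookup_eq_0:
  assumes "bihomogeneous A B f"
    and "Poly_Mapping.lookup m 1 + Poly_Mapping.lookup m 3 \<noteq> A \<or>
         Poly_Mapping.lookup m 2 + Poly_Mapping.lookup m 4 \<noteq> B"
  shows "Poly_Mapping.lookup f m = 0"
  using assms by (auto simp: bihomogeneous_def in_keys_iff)

text \<open>Exchange towards the upper corner moves one step at a time: lowering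
  \<open>x\<^sub>1\<close> can only be balanced by raising \<open>x\<^sub>3\<close>, and lowering
  \<open>x\<^sub>4\<close> only by raising \<open>x\<^sub>2\<close>. First \<open>i\<close> is
  raised at \<open>j0\<close>, then \<open>j\<close> is raised at the given
  \<open>i\<close>.\<close>

lemma bihomogeneous_M_convex_rectangle:
  assumes bi: "bihomogeneous A B f" and M: "M_convex 4 (Poly_Mapping.keys f)"
    and lo: "bimonomial A B i0 j0 \<in> Poly_Mapping.keys f"
    and hi: "bimonomial A B i1 j1 \<in> Poly_Mapping.keys f"
    and i: "i0 \<le> i" "i \<le> i1" and j: "j0 \<le> j" "j \<le> j1"
  shows "bimonomial A B i j \<in> Poly_Mapping.keys f"
proof -
  have A: "i1 \<le> A" and B: "j1 \<le> B"
    using bi hi by (force simp: bihomogeneous_def)+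
  have 1: "bimonomial A B i j0 \<in> Poly_Mapping.keys f"
    using i
  proof (induction i rule: dec_induct)
    case (step i)
    let ?\<alpha> = "bimonomial A B i j0" and ?\<beta> = "bimonomial A B i1 j1"
    have "Poly_Mapping.lookup ?\<alpha> 1 > Poly_Mapping.lookup ?\<beta> 1"
      using step A by simp
    then obtain k where k: "k \<in> {1..4}" "Poly_Mapping.lookup ?\<alpha> k < Poly_Mapping.lookup ?\<beta> k"
      "?\<alpha> - unit_exp 1 + unit_exp k \<in> Poly_Mapping.keys f"
      using M step hi unfolding M_convex_def by (metis atLeastAtMost_iff le_refl one_le_numeral Suc_leD less_imp_le_nat)
    \<comment> \<open>The new monomial still has bidegree \<open>(A, B)\<close>, so the raised
      variable belongs to the same pair as the lowered one; it is not the lowered one, whose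
      exponent in \<open>?\<alpha>\<close> exceeds that in \<open>?\<beta>\<close>.\<close>
    then have "Poly_Mapping.lookup (?\<alpha> - unit_exp 1 + unit_exp k) 1
        + Poly_Mapping.lookup (?\<alpha> - unit_exp 1 + unit_exp k) 3 = A"
      "Poly_Mapping.lookup (?\<alpha> - unit_exp 1 + unit_exp k) 2
        + Poly_Mapping.lookup (?\<alpha> - unit_exp 1 + unit_exp k) 4 = B"
      using bi by (auto simp: bihomogeneous_def)
    with k(1,2) have "k = 3"
      using step i A B unfolding atLeastAtMost_1_4
      by (auto simp: lookup_add lookup_minus lookup_single)
    moreover have "?\<alpha> - unit_exp 1 + unit_exp 3 = bimonomial A B (Suc i) j0"
      using step A
      by (intro poly_mapping_eqI) (auto simp: bimonomial_def lookup_add lookup_minus lookup_single when_def)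
    ultimately show ?case using k by simp
  qed (use lo in simp)
  show ?thesis
    using j
  proof (induction j rule: dec_induct)
    case (step j)
    let ?\<alpha> = "bimonomial A B i j" and ?\<beta> = "bimonomial A B i1 j1"
    have "Poly_Mapping.lookup ?\<alpha> 4 > Poly_Mapping.lookup ?\<beta> 4"
      using step B by simp
    then obtain k where k: "k \<in> {1..4}" "Poly_Mapping.lookup ?\<alpha> k < Poly_Mapping.lookup ?\<beta> k"
      "?\<alpha> - unit_exp 4 + unit_exp k \<in> Poly_Mapping.keys f"
      using M step hi unfolding M_convex_def by (metis atLeastAtMost_iff le_refl one_le_numeral Suc_leD less_imp_le_nat)
    then have "Poly_Mapping.lookup (?\<alpha> - unit_exp 4 + unit_exp k) 1
        + Poly_Mapping.lookup (?\<alpha> - unit_exp 4 + unit_exp k) 3 = A"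
      "Poly_Mapping.lookup (?\<alpha> - unit_exp 4 + unit_exp k) 2
        + Poly_Mapping.lookup (?\<alpha> - unit_exp 4 + unit_exp k) 4 = B"
      using bi by (auto simp: bihomogeneous_def)
    with k(1,2) have "k = 2"
      using step i A B unfolding atLeastAtMost_1_4
      by (auto simp: lookup_add lookup_minus lookup_single)
    moreover have "?\<alpha> - unit_exp 4 + unit_exp 2 = bimonomial A B i (Suc j)"
      using step B
      by (intro poly_mapping_eqI) (auto simp: bimonomial_def lookup_add lookup_minus lookup_single when_def)
    ultimately show ?case using k by simp
  qed (use 1 in simp)
qed

text \<open>Any monomial of a nonzero \<open>f\<close> identifies the existential degree in
  \<open>denormalized_lorentzian\<close> with \<open>d\<close>. For \<open>d = 2\<close> the list
  \<open>js\<close> is empty and the form itself is meant.\<close>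

lemma denormalized_lorentzianD:
  assumes "denormalized_lorentzian n f" "homogeneous n d f" "f \<noteq> 0" "d \<ge> 2"
  shows "M_convex n (Poly_Mapping.keys f)"
    and "length js = d - 2 \<Longrightarrow> set js \<subseteq> {1..n} \<Longrightarrow>
      at_most_one_pos_eigenvalue (quadratic_hessian n (foldr partial js (normalization_op f)))"
proof -
  obtain m where "m \<in> Poly_Mapping.keys f"
    using \<open>f \<noteq> 0\<close> by fastforce
  with assms have L: "lorentzian n d (normalization_op f)"
    unfolding denormalized_lorentzian_def homogeneous_def by metis
  show "M_convex n (Poly_Mapping.keys f)"
    using L \<open>d \<ge> 2\<close>
    by (auto simp: lorentzian_def lorentzian_quadratic_def keys_normalization_op split: if_splits)
  show "at_most_one_pos_eigenvalue (quadratic_hessian n (foldr partial js (normalization_op f)))"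
    if "length js = d - 2" "set js \<subseteq> {1..n}"
    using L that \<open>d \<ge> 2\<close>
    by (auto simp: lorentzian_def lorentzian_quadratic_def split: if_splits)
qed

lemma denormalized_lorentzian_adjacent_minor:
  assumes L: "denormalized_lorentzian 4 f" and hom: "homogeneous 4 (A + B) f" and "f \<noteq> 0"
    and bi: "bihomogeneous A B f" and i: "i < A" and j: "j < B"
  defines "a \<equiv> \<lambda>i j. Poly_Mapping.lookup f (bimonomial A B i j)"
  shows "a i j * a (Suc i) (Suc j) = a (Suc i) j * a i (Suc j)"
proof -
  \<comment> \<open>These \<open>A + B - 2\<close> derivatives leave room for two more variables.
    One from each pair completes them to the monomial at \<open>(i, j)\<close> by
    \<open>x\<^sub>1 x\<^sub>4\<close>, at \<open>(i + 1, j)\<close> by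
    \<open>x\<^sub>3 x\<^sub>4\<close>, at \<open>(i, j + 1)\<close> by
    \<open>x\<^sub>1 x\<^sub>2\<close>, and at \<open>(i + 1, j + 1)\<close> by
    \<open>x\<^sub>3 x\<^sub>2\<close>.\<close>
  define js where "js = replicate (A - Suc i) 1 @ replicate j 2 @ replicate i 3
    @ replicate (B - Suc j) (4::nat)"
  have sum_js: "(\<Sum>k\<leftarrow>js. unit_exp k) = Poly_Mapping.single 1 (A - Suc i) + Poly_Mapping.single 2 j
     + Poly_Mapping.single 3 i + Poly_Mapping.single 4 (B - Suc j)"
    by (simp only: js_def map_append sum_list.append sum_list_replicate_unit_exp add.assoc)
  define H where "H = quadratic_hessian 4 (foldr partial js (normalization_op f))"
  have H_entry: "H $$ (k, l) = Poly_Mapping.lookup f (unit_exp (Suc k) + unit_exp (Suc l)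
      + (\<Sum>k\<leftarrow>js. unit_exp k))" if "k < 4" "l < 4" for k l
    unfolding H_def using that by (rule quadratic_hessian_foldr_partial)
  have "at_most_one_pos_eigenvalue H"
    unfolding H_def using i j
    by (intro denormalized_lorentzianD(2)[OF L hom \<open>f \<noteq> 0\<close>]) (auto simp: js_def)
  moreover have "H $$ (k, l) = H $$ (l, k)" if "k < 4" "l < 4" for k l
    using that by (simp only: H_entry add.commute)
  \<comment> \<open>Indices of equal parity belong to the same pair of variables, which gives
    bidegree \<open>(A + 1, B - 1)\<close> or \<open>(A - 1, B + 1)\<close>.\<close>
  moreover have "H $$ (k, l) = 0" if kl: "k < 4" "l < 4" "even (k + l)" for k l
  proof -
    have "(k = 0 \<or> k = 2) \<and> (l = 0 \<or> l = 2) \<or> (k = 1 \<or> k = 3) \<and> (l = 1 \<or> l = 3)"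
      using kl by presburger
    then show ?thesis
      unfolding H_entry[OF kl(1,2)] sum_js using i j
      by (intro bihomogeneous_lookup_eq_0[OF bi]) (auto simp: lookup_add lookup_single)
  qed
  moreover have "H \<in> carrier_mat 4 4"
    by (simp add: H_def quadratic_hessian_def)
  ultimately have minor: "H $$ (0,3) * H $$ (2,1) = H $$ (0,1) * H $$ (2,3)"
    by (intro bipartite_hessian_singular) auto
  have H_eq: "H $$ (k, l) = a i' j'" if "k < 4" "l < 4"
    "unit_exp (Suc k) + unit_exp (Suc l) + (Poly_Mapping.single 1 (A - Suc i)
      + Poly_Mapping.single 2 j + Poly_Mapping.single 3 i + Poly_Mapping.single 4 (B - Suc j))
      = bimonomial A B i' j'" for k l i' j'
    by (simp only: H_entry[OF that(1,2)] sum_js that(3) a_def)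
  have "H $$ (0,3) = a i j" "H $$ (2,1) = a (Suc i) (Suc j)"
    "H $$ (0,1) = a i (Suc j)" "H $$ (2,3) = a (Suc i) j"
    by (rule H_eq, simp, simp, rule poly_mapping_eqI,
      use i j in \<open>auto simp: bimonomial_def lookup_add lookup_single when_def\<close>)+
  with minor show ?thesis by (simp add: mult.commute)
qed

lemma denormalized_lorentzian_bihomogeneous_corner_minor:
  assumes L: "denormalized_lorentzian 4 f" and hom: "homogeneous 4 (A + B) f"
    and bi: "bihomogeneous A B f"
  defines "a \<equiv> \<lambda>i j. Poly_Mapping.lookup f (bimonomial A B i j)"
  assumes nz: "a i0 j0 \<noteq> 0" "a i1 j1 \<noteq> 0" and lt: "i0 < i1" "j0 < j1"
  shows "a i0 j0 * a i1 j1 = a i1 j0 * a i0 j1"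
proof -
  have hi: "bimonomial A B i1 j1 \<in> Poly_Mapping.keys f"
    and lo: "bimonomial A B i0 j0 \<in> Poly_Mapping.keys f"
    using nz by (auto simp: a_def in_keys_iff)
  then have "f \<noteq> 0"
    by auto
  have A: "i1 \<le> A" and B: "j1 \<le> B"
    using bi hi by (force simp: bihomogeneous_def)+
  note M = denormalized_lorentzianD(1)[OF L hom \<open>f \<noteq> 0\<close>]
  show ?thesis
  proof (rule adjacent_minors_imp_corner_minor)
    fix i j assume "i \<in> {i0..i1}" "j \<in> {j0..j1}"
    then have "bimonomial A B i j \<in> Poly_Mapping.keys f"
      using lt A B by (intro bihomogeneous_M_convex_rectangle[OF bi M lo hi]) auto
    then show "a i j \<noteq> 0"
      by (simp add: a_def in_keys_iff)
  next
    fix i j assume "i \<in> {i0..<i1}" "j \<in> {j0..<j1}"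
    then show "a i j * a (Suc i) (Suc j) = a (Suc i) j * a i (Suc j)"
      unfolding a_def using A B
      by (intro denormalized_lorentzian_adjacent_minor[OF L hom \<open>f \<noteq> 0\<close> bi]) auto
  qed (use lt in auto)
qed

section \<open>Spanning out-trees\<close>

lemma (in wf_digraph) awalk_snoc:
  assumes "awalk u p (tail G e)" "e \<in> arcs G"
  shows "awalk u (p @ [e]) (head G e)"
  using assms by (intro awalk_appendI[OF assms(1)] arc_implies_awalk) auto

lemma (in wf_digraph) awalk_snocD:
  assumes "awalk u (p @ [e]) v"
  shows "awalk u p (tail G e)" "e \<in> arcs G" "head G e = v"
  using assms by (auto simp: awalk_Cons_iff awalk_Nil_iff)

lemma out_tree_walk:
  assumes "out_tree T r" "v \<in> verts T"
  obtains p where "pre_digraph.awalk T r p v"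
  using assms unfolding out_tree_def by blast

lemma out_tree_walk_unique:
  assumes T: "out_tree T r" and p: "pre_digraph.awalk T r p v" "pre_digraph.awalk T r p' v"
  shows "p = p'"
proof -
  interpret wf_digraph T using T by (simp add: out_tree_def)
  have "v \<in> verts T"
    using p(1) by (rule awalk_last_in_verts)
  with T have "\<exists>!p. awalk r p v"
    unfolding out_tree_def by simp
  then show ?thesis
    using p by (elim ex1E) metis
qed

text \<open>An edge into the root would close a nonempty walk at the root, beside the empty
  one.\<close>

lemma out_tree_head_neq_root:
  assumes T: "out_tree T r" and e: "e \<in> arcs T"
  shows "head T e \<noteq> r"
proof
  assume r: "head T e = r"
  interpret wf_digraph T using T by (simp add: out_tree_def)
  obtain p where "awalk r p (tail T e)"
    using T tail_in_verts[OF e] by (rule out_tree_walk)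
  then have "awalk r (p @ [e]) r"
    using awalk_snoc e r by metis
  moreover have "awalk r [] r"
    using head_in_verts[OF e] by (simp only: r awalk_Nil_iff)
  ultimately have "p @ [e] = []"
    by (rule out_tree_walk_unique[OF T])
  then show False by simp
qed

text \<open>Two edges with a common head would end two different walks from the root to it.\<close>

lemma out_tree_inj_on_head:
  assumes T: "out_tree T r"
  shows "inj_on (head T) (arcs T)"
proof (rule inj_onI)
  fix e e' assume e: "e \<in> arcs T" "e' \<in> arcs T" "head T e = head T e'"
  interpret wf_digraph T using T by (simp add: out_tree_def)
  obtain p where "awalk r p (tail T e)"
    using T tail_in_verts[OF e(1)] by (rule out_tree_walk)
  moreover obtain p' where "awalk r p' (tail T e')"
    using T tail_in_verts[OF e(2)] by (rule out_tree_walk)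
  ultimately have "awalk r (p @ [e]) (head T e)" "awalk r (p' @ [e']) (head T e)"
    using awalk_snoc e by metis+
  then have "p @ [e] = p' @ [e']"
    by (rule out_tree_walk_unique[OF T])
  then show "e = e'" by simp
qed

lemma out_tree_head_image:
  assumes T: "out_tree T r"
  shows "head T ` arcs T = verts T - {r}"
proof (intro equalityI subsetI)
  interpret wf_digraph T using T by (simp add: out_tree_def)
  fix v
  show "v \<in> verts T - {r}" if "v \<in> head T ` arcs T"
    using that out_tree_head_neq_root[OF T] head_in_verts by blast
  assume v: "v \<in> verts T - {r}"
  then have "v \<in> verts T" by simp
  with T obtain p where p: "awalk r p v"
    by (rule out_tree_walk)
  show "v \<in> head T ` arcs T"
  proof (cases p rule: rev_exhaust)
    case Nil
    with p v show ?thesis by (simp add: awalk_Nil_iff)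
  next
    case (snoc q e)
    with p show ?thesis using awalk_snocD(2,3) by blast
  qed
qed

text \<open>Uniqueness of walks is shown backwards from their end: the last edge is determined by
  its head, and no nonempty walk ends at the root.\<close>

lemma out_treeI:
  assumes "wf_digraph T" "r \<in> verts T" "inj_on (head T) (arcs T)"
    and root: "\<And>e. e \<in> arcs T \<Longrightarrow> head T e \<noteq> r"
    and walk: "\<And>v. v \<in> verts T \<Longrightarrow> \<exists>p. pre_digraph.awalk T r p v"
  shows "out_tree T r"
proof -
  interpret wf_digraph T by fact
  have "p = p'" if "awalk r p v" "awalk r p' v" for p p' v
    using that
  proof (induction p arbitrary: p' v rule: rev_induct)
    case Nil
    then have "v = r"
      by (simp add: awalk_Nil_iff)
    show ?case
    proof (cases p' rule: rev_exhaust)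
      case (snoc q e)
      with Nil \<open>v = r\<close> show ?thesis
        using root awalk_snocD(2,3) by blast
    qed simp
  next
    case (snoc e p)
    note e = awalk_snocD[OF snoc.prems(1)]
    show ?case
    proof (cases p' rule: rev_exhaust)
      case Nil
      then have "v = r"
        using snoc.prems(2) by (simp add: awalk_Nil_iff)
      then show ?thesis using e root by blast
    next
      case (snoc q e')
      note e' = awalk_snocD[OF \<open>awalk r p' v\<close>[unfolded snoc]]
      have "e = e'"
        by (rule inj_onD[OF assms(3) _ e(2) e'(2)]) (simp only: e(3) e'(3))
      with snoc.IH[OF e(1)] e'(1) snoc show ?thesis by simp
    qed
  qed
  with walk have "\<exists>!p. awalk r p v" if "v \<in> verts T" for v
    using that by blast
  then show ?thesis
    unfolding out_tree_def using assms(1,2) by blast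
qed

section \<open>Spanning out-trees of a fixed digraph\<close>

lemma spanning_out_treesD:
  assumes "T \<in> spanning_out_trees G r"
  shows "verts T = verts G" "arcs T \<subseteq> arcs G" "tail T = tail G" "head T = head G" "out_tree T r"
  using assms
  by (auto simp: spanning_out_trees_def spanning_def subgraph_def compatible_def)

lemma spanning_out_tree_inj_on_head:
  assumes "T \<in> spanning_out_trees G r"
  shows "inj_on (head G) (arcs T)"
  using out_tree_inj_on_head[OF spanning_out_treesD(5)[OF assms]]
  by (simp only: spanning_out_treesD(4)[OF assms])

lemma spanning_out_tree_head_image:
  assumes "T \<in> spanning_out_trees G r"
  shows "head G ` arcs T = verts G - {r}"
  using out_tree_head_image[OF spanning_out_treesD(5)[OF assms]]
  by (simp only: spanning_out_treesD(1,4)[OF assms])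

text \<open>Induction along the walk from the root. Read contrapositively, it provides a tree edge
  that leaves a given proper vertex set containing the root.\<close>

lemma spanning_out_tree_closed:
  assumes T: "T \<in> spanning_out_trees G r" and "r \<in> S"
    and closed: "\<And>e. e \<in> arcs T \<Longrightarrow> tail G e \<in> S \<Longrightarrow> head G e \<in> S"
  shows "verts G \<subseteq> S"
proof
  fix v assume v: "v \<in> verts G"
  note T = spanning_out_treesD[OF T]
  interpret wf_digraph T using T by (simp add: out_tree_def)
  obtain p where p: "awalk r p v"
    using T(5) v unfolding T(1)[symmetric] by (rule out_tree_walk)
  have "v \<in> S" if "awalk u p v" "u \<in> S" for u
    using that
  proof (induction p arbitrary: u)
    case Nil
    then show ?case by (simp add: awalk_Nil_iff)
  next
    case (Cons e p)
    then have e: "e \<in> arcs T" "tail G e \<in> S" "awalk (head G e) p v"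
      by (simp_all add: awalk_Cons_iff T(3,4))
    then show ?case
      using Cons.IH closed by blast
  qed
  with p \<open>r \<in> S\<close> show "v \<in> S" by blast
qed

text \<open>Reachability is phrased through closed sets, so that applications argue by closure
  instead of building walks. In the proof, \<open>S\<close> is the set of endpoints of walks from
  the root.\<close>

lemma restricted_arcs_spanning_out_tree:
  assumes G: "wf_digraph G" and F: "F \<subseteq> arcs G" "inj_on (head G) F" and r: "r \<in> verts G"
    and root: "\<And>e. e \<in> F \<Longrightarrow> head G e \<noteq> r"
    and reach: "\<And>S. r \<in> S \<Longrightarrow> (\<And>e. e \<in> F \<Longrightarrow> tail G e \<in> S \<Longrightarrow> head G e \<in> S) \<Longrightarrow> verts G \<subseteq> S"
  shows "G\<lparr>arcs := F\<rparr> \<in> spanning_out_trees G r"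
proof -
  let ?T = "G\<lparr>arcs := F\<rparr>"
  interpret G: wf_digraph G by fact
  interpret T: wf_digraph ?T
    by unfold_locales (use F in auto)
  have "verts G \<subseteq> {v. \<exists>p. T.awalk r p v}"
  proof (rule reach)
    show "r \<in> {v. \<exists>p. T.awalk r p v}"
      using r by (auto simp: T.awalk_Nil_iff intro!: exI[of _ "[]"])
    fix e assume "e \<in> F" "tail G e \<in> {v. \<exists>p. T.awalk r p v}"
    then obtain p where "T.awalk r p (tail ?T e)" "e \<in> arcs ?T"
      by auto
    then have "T.awalk r (p @ [e]) (head ?T e)"
      by (rule T.awalk_snoc)
    then show "head G e \<in> {v. \<exists>p. T.awalk r p v}"
      by (auto simp del: T.awalk_append_iff)
  qed
  then have "\<exists>p. T.awalk r p v" if "v \<in> verts ?T" for v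
    using that by auto
  then have "out_tree ?T r"
    by (intro out_treeI T.wf_digraph_axioms) (simp_all add: F r root)
  moreover have "spanning ?T G"
    using F G T.wf_digraph_axioms by (auto simp: spanning_def subgraph_def compatible_def)
  ultimately show ?thesis by (simp add: spanning_out_trees_def)
qed

lemma spanning_out_trees_eqI:
  assumes T: "T \<in> spanning_out_trees G r" and T': "T' \<in> spanning_out_trees G r"
    and "arcs T = arcs T'"
  shows "T = T'"
  using spanning_out_treesD(1-4)[OF T] spanning_out_treesD(1-4)[OF T'] assms
  by (cases T; cases T') simp

text \<open>A spanning out-tree enters each vertex other than the root by exactly one edge. If the
  admissible edges have distinct heads, there is no choice left. This yields the upper bounds on
  tree counts.\<close>

lemma spanning_out_trees_unique:
  assumes T: "T \<in> spanning_out_trees G r" and T': "T' \<in> spanning_out_trees G r"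
    and S: "arcs T \<subseteq> S" "arcs T' \<subseteq> S" and inj: "inj_on (head G) S"
  shows "T = T'"
proof (rule spanning_out_trees_eqI[OF T T'])
  have "head G ` arcs T = head G ` arcs T'"
    using spanning_out_tree_head_image T T' by metis
  then show "arcs T = arcs T'"
    using inj_on_image_eq_iff[OF inj S] by simp
qed

lemma finite_spanning_out_trees:
  assumes "finite (arcs G)"
  shows "finite (spanning_out_trees G r)"
proof (rule finite_imageD)
  have "arcs ` spanning_out_trees G r \<subseteq> Pow (arcs G)"
    by (rule image_subsetI) (simp only: Pow_iff spanning_out_treesD(2))
  then show "finite (arcs ` spanning_out_trees G r)"
    by (rule finite_subset) (simp add: assms)
  show "inj_on arcs (spanning_out_trees G r)"
    by (rule inj_onI) (rule spanning_out_trees_eqI)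
qed

section \<open>Coefficients of the tree polynomial as numbers of trees\<close>

lemma prod_mvar: "(\<Prod>e\<in>F. mvar (x e)) = Poly_Mapping.single (\<Sum>e\<in>F. unit_exp (x e)) 1"
  by (induction F rule: infinite_finite_induct) (auto simp: mvar_def mult_single)

lemma lookup_tree_polynomial:
  assumes fin: "finite (arcs G)" and wt: "\<And>e. e \<in> arcs G \<Longrightarrow> wt e = mvar (x e)"
  shows "Poly_Mapping.lookup (tree_polynomial G wt r) m
    = real (card {T \<in> spanning_out_trees G r. (\<Sum>e\<in>arcs T. unit_exp (x e)) = m})"
proof -
  have "tree_polynomial G wt r
      = (\<Sum>T \<in> spanning_out_trees G r. Poly_Mapping.single (\<Sum>e\<in>arcs T. unit_exp (x e)) 1)"
    unfolding tree_polynomial_def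
  proof (intro sum.cong refl)
    fix T assume "T \<in> spanning_out_trees G r"
    then have "arcs T \<subseteq> arcs G"
      by (rule spanning_out_treesD)
    then have "(\<Prod>e\<in>arcs T. wt e) = (\<Prod>e\<in>arcs T. mvar (x e))"
      by (intro prod.cong refl wt) blast
    then show "(\<Prod>e\<in>arcs T. wt e) = Poly_Mapping.single (\<Sum>e\<in>arcs T. unit_exp (x e)) 1"
      by (simp only: prod_mvar)
  qed
  then show ?thesis
    using finite_spanning_out_trees[OF fin]
    by (simp add: lookup_sum lookup_single when_def sum.If_cases Int_def)
qed

lemma lookup_sum_unit_exp:
  assumes "finite F"
  shows "Poly_Mapping.lookup (\<Sum>e\<in>F. unit_exp (x e)) v = card {e \<in> F. x e = v}"
  using assms by (simp add: lookup_sum lookup_single when_def sum.If_cases Int_def)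

section \<open>Spanning trees of the refined Crowell graph\<close>

lemma fst_crossing_at [simp]: "fst (crossing_at w i) = w ! i"
  by (simp add: crossing_at_def)

text \<open>The running count of a letter grows strictly at each position carrying that
  letter.\<close>

lemma inj_on_crossing_at: "inj_on (crossing_at w) {..<length w}"
proof -
  have less: "count_list (take (Suc i) w) x < count_list (take (Suc j) w) x"
    if "i < j" "j < length w" "w ! j = x" for i j x
  proof -
    have "take j w = take (Suc i) w @ take (j - Suc i) (drop (Suc i) w)"
      using that take_add[of "Suc i" "j - Suc i" w] by simp
    then have "count_list (take (Suc i) w) x \<le> count_list (take j w) x"
      by simp
    then show ?thesis
      using that by (simp add: take_Suc_conv_app_nth)
  qed
  show ?thesis
  proof (rule inj_onI)
    fix i j assume ij: "i \<in> {..<length w}" "j \<in> {..<length w}"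
      and "crossing_at w i = crossing_at w j"
    then have "w ! i = w ! j"
      "count_list (take (Suc i) w) (w ! j) = count_list (take (Suc j) w) (w ! j)"
      by (auto simp only: crossing_at_def prod.inject)
    then show "i = j"
      using less[of i j "w ! j"] less[of j i "w ! j"] ij
      by (cases i j rule: linorder_cases) auto
  qed
qed

lemma UNIV_letter: "UNIV = {Sigma1, Sigma2_inv}"
  using letter.exhaust by auto

lemma crossings_eq: "crossings w = (SIGMA l:UNIV. {1..count_list w l})"
  by (auto simp: crossings_def)

lemma finite_crossings: "finite (crossings w)"
  unfolding crossings_eq UNIV_letter by (intro finite_SigmaI) auto

lemma card_crossings: "card (crossings w) = length w"
proof -
  have "card (crossings w) = count_list w Sigma1 + count_list w Sigma2_inv"
    unfolding crossings_eq UNIV_letter by (subst card_SigmaI) auto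
  also have "\<dots> = length w"
  proof (induction w)
    case (Cons l w)
    then show ?case by (cases l) auto
  qed simp
  finally show ?thesis .
qed

text \<open>Surjectivity comes from counting: the map is injective, and there are as many crossings
  as positions.\<close>

lemma crossing_at_image: "crossing_at w ` {..<length w} = crossings w"
proof (rule card_subset_eq[OF finite_crossings])
  show "crossing_at w ` {..<length w} \<subseteq> crossings w"
  proof
    fix c assume "c \<in> crossing_at w ` {..<length w}"
    then obtain i where i: "i < length w" "c = crossing_at w i"
      by auto
    have "count_list (take (Suc i) w @ drop (Suc i) w) (w ! i) \<ge> count_list (take (Suc i) w) (w ! i)"
      unfolding count_list_append by simp
    then have "count_list (take (Suc i) w) (w ! i) \<le> count_list w (w ! i)"
      by (simp only: append_take_drop_id)
    moreover have "1 \<le> count_list (take (Suc i) w) (w ! i)"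
      using i by (simp add: take_Suc_conv_app_nth)
    ultimately show "c \<in> crossings w"
      unfolding i crossings_def crossing_at_def by simp
  qed
  show "card (crossing_at w ` {..<length w}) = card (crossings w)"
    by (simp add: card_image inj_on_crossing_at card_crossings)
qed

lemma crossing_at_in_crossings [simp]: "i < length w \<Longrightarrow> crossing_at w i \<in> crossings w"
  unfolding crossing_at_image[symmetric] by simp

lemma crossing_at_eq_iff:
  "i < length w \<Longrightarrow> j < length w \<Longrightarrow> crossing_at w i = crossing_at w j \<longleftrightarrow> i = j"
  by (simp add: inj_on_eq_iff[OF inj_on_crossing_at])

lemma crossing_at_0: "w \<noteq> [] \<Longrightarrow> w ! 0 = Sigma1 \<Longrightarrow> crossing_at w 0 = (Sigma1, 1)"
  by (cases w) (auto simp: crossing_at_def)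

lemma crowell_graph_simps [simp]:
  "verts (crowell_graph w) = crossings w"
  "arcs (crowell_graph w) = Level_edge ` crossings w \<union> Word_edge ` {..<length w}"
  "tail (crowell_graph w) = crowell_tail w"
  "head (crowell_graph w) = crowell_head w"
  by (simp_all add: crowell_graph_def)

lemma finite_arcs_crowell_graph: "finite (arcs (crowell_graph w))"
  by (simp add: finite_crossings)

lemma wf_digraph_crowell_graph: "wf_digraph (crowell_graph w)"
proof
  fix e assume e: "e \<in> arcs (crowell_graph w)"
  then show "tail (crowell_graph w) e \<in> verts (crowell_graph w)"
    by auto
  show "head (crowell_graph w) e \<in> verts (crowell_graph w)"
  proof (cases e)
    case (Level_edge c)
    with e show ?thesis
      by (cases c) (auto simp: crossings_def)
  next
    case (Word_edge i)
    with e have "Suc i mod length w < length w"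
      by (intro mod_less_divisor) auto
    with Word_edge show ?thesis by simp
  qed
qed

lemma fst_crowell_head_Level_edge [simp]: "fst (crowell_head w (Level_edge c)) = fst c"
  by (cases c) simp

lemma inj_on_crowell_head_Level_edge: "inj_on (crowell_head w) (Level_edge ` crossings w)"
proof (rule inj_onI)
  fix e e' assume "e \<in> Level_edge ` crossings w" "e' \<in> Level_edge ` crossings w"
    and eq: "crowell_head w e = crowell_head w e'"
  then obtain l k l' k' where e: "e = Level_edge (l, k)" "e' = Level_edge (l', k')"
    and k: "1 \<le> k" "k \<le> count_list w l" "1 \<le> k'" "k' \<le> count_list w l'"
    by (auto simp: crossings_def)
  have l: "l = l'"
    using eq by (simp add: e)
  have "(if k = 1 then count_list w l else k - 1) = (if k' = 1 then count_list w l else k' - 1)"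
    using eq unfolding e l by simp
  with k l have "k = k'"
    by (cases "k = 1"; cases "k' = 1") auto
  with l show "e = e'"
    unfolding e by simp
qed

lemma Suc_mod_inject:
  fixes n :: nat
  assumes "i < n" "j < n" "Suc i mod n = Suc j mod n"
  shows "i = j"
  using assms by (simp add: mod_Suc split: if_splits)

lemma inj_on_crowell_head_Word_edge: "inj_on (crowell_head w) (Word_edge ` {..<length w})"
proof (rule inj_onI)
  fix e e' assume "e \<in> Word_edge ` {..<length w}" "e' \<in> Word_edge ` {..<length w}"
    and eq: "crowell_head w e = crowell_head w e'"
  then obtain i j where e: "e = Word_edge i" "e' = Word_edge j" and ij: "i < length w" "j < length w"
    by blast
  have "0 < length w"
    using ij by linarith
  then have "Suc i mod length w = Suc j mod length w"
    using eq unfolding e crowell_head.simps by (simp only: crossing_at_eq_iff mod_less_divisor)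
  then have "i = j"
    by (rule Suc_mod_inject[OF ij])
  then show "e = e'"
    unfolding e by (rule arg_cong)
qed

section \<open>Weights of edges as indices of variables\<close>

definition crowell_var :: "letter list \<Rightarrow> crowell_edge \<Rightarrow> nat" where
  "crowell_var w e = (case e of
     Level_edge c \<Rightarrow> if fst c = Sigma1 then 1 else 4
   | Word_edge i \<Rightarrow> if fst (crowell_head w e) = Sigma1 then 3 else 2)"

lemma crowell_weight_eq: "crowell_weight w e = mvar (crowell_var w e)"
proof (cases e)
  case (Level_edge c)
  then show ?thesis
    by (cases c; cases "fst c") (auto simp: crowell_var_def)
next
  case (Word_edge i)
  then show ?thesis
    by (cases "fst (crowell_head w e)") (simp_all only: crowell_var_def crowell_weight.simps
      crowell_edge.case letter.case if_True if_False letter.distinct simp_thms)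
qed

lemma crowell_var_range: "crowell_var w e \<in> {1, 2, 3, 4}"
  by (cases e) (simp_all add: crowell_var_def)

text \<open>A level edge keeps its letter, so for both kinds of edges the letter of the head decides
  the pair of variables. This is the source of bihomogeneity.\<close>

lemma crowell_var_Sigma1_iff:
  "crowell_var w e = 1 \<or> crowell_var w e = 3 \<longleftrightarrow> fst (crowell_head w e) = Sigma1"
  by (cases e) (auto simp: crowell_var_def simp del: crowell_head.simps)

text \<open>The variable tells level edges from word edges, and each of these two families enters
  every crossing only once.\<close>

lemma crowell_head_var_inject:
  assumes "e \<in> arcs (crowell_graph w)" "e' \<in> arcs (crowell_graph w)"
    and "crowell_head w e = crowell_head w e'" "crowell_var w e = crowell_var w e'"
  shows "e = e'"
proof (cases "crowell_var w e \<in> {1, 4}")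
  case True
  then have "e \<in> Level_edge ` crossings w" "e' \<in> Level_edge ` crossings w"
    using assms by (cases e; cases e'; auto simp: crowell_var_def simp del: crowell_head.simps split: if_splits)+
  then show ?thesis
    using assms(3) inj_onD[OF inj_on_crowell_head_Level_edge] by blast
next
  case False
  then have "e \<in> Word_edge ` {..<length w}" "e' \<in> Word_edge ` {..<length w}"
    using assms by (cases e; cases e'; auto simp: crowell_var_def simp del: crowell_head.simps split: if_splits)+
  then show ?thesis
    using assms(3) inj_onD[OF inj_on_crowell_head_Word_edge] by blast
qed

section \<open>Exponents of trees and bihomogeneity\<close>

abbreviation crowell_trees :: "letter list \<Rightarrow> (crossing, crowell_edge) pre_digraph set" where
  "crowell_trees w \<equiv> spanning_out_trees (crowell_graph w) (Sigma1, 1)"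

definition var_arcs :: "letter list \<Rightarrow> (crossing, crowell_edge) pre_digraph \<Rightarrow> nat \<Rightarrow> crowell_edge set" where
  "var_arcs w T v = {e \<in> arcs T. crowell_var w e = v}"

lemma crowell_tree_arcs_subset: "T \<in> crowell_trees w \<Longrightarrow> arcs T \<subseteq> arcs (crowell_graph w)"
  by (rule spanning_out_treesD)

lemma crowell_tree_finite_arcs: "T \<in> crowell_trees w \<Longrightarrow> finite (arcs T)"
  by (rule finite_subset[OF crowell_tree_arcs_subset finite_arcs_crowell_graph])

lemma finite_var_arcs: "T \<in> crowell_trees w \<Longrightarrow> finite (var_arcs w T v)"
  unfolding var_arcs_def by (simp add: crowell_tree_finite_arcs)

text \<open>Taking heads is a bijection from the tree edges to the crossings other than the
  root.\<close>

lemma crowell_tree_card_head: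
  assumes T: "T \<in> crowell_trees w"
  shows "card {e \<in> arcs T. fst (crowell_head w e) = l} = card {c \<in> crossings w - {(Sigma1, 1)}. fst c = l}"
proof -
  have "crowell_head w ` {e \<in> arcs T. fst (crowell_head w e) = l}
      = {c \<in> crowell_head w ` arcs T. fst c = l}"
    by auto
  also have "crowell_head w ` arcs T = crossings w - {(Sigma1, 1)}"
    using spanning_out_tree_head_image[OF T] by simp
  finally have "{c \<in> crossings w - {(Sigma1, 1)}. fst c = l}
      = crowell_head w ` {e \<in> arcs T. fst (crowell_head w e) = l}" ..
  moreover have "inj_on (crowell_head w) {e \<in> arcs T. fst (crowell_head w e) = l}"
    using spanning_out_tree_inj_on_head[OF T] by (simp add: inj_on_def)
  ultimately show ?thesis by (simp add: card_image)
qed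

lemma crossings_of_letter: "{c \<in> crossings w. fst c = l} = Pair l ` {1..count_list w l}"
  by (auto simp: crossings_def)

lemma card_nonroot_Sigma1:
  "card {c \<in> crossings w - {(Sigma1, 1)}. fst c = Sigma1} = count_list w Sigma1 - 1"
proof -
  have "{c \<in> crossings w - {(Sigma1, 1)}. fst c = Sigma1} = Pair Sigma1 ` ({1..count_list w Sigma1} - {1})"
    using crossings_of_letter[of w Sigma1] by auto
  also have "card \<dots> = card ({1..count_list w Sigma1} - {1})"
    by (rule card_image) (simp add: inj_on_def)
  also have "\<dots> = count_list w Sigma1 - 1"
    by (cases "count_list w Sigma1") simp_all
  finally show ?thesis .
qed

lemma card_nonroot_Sigma2_inv:
  "card {c \<in> crossings w - {(Sigma1, 1)}. fst c = Sigma2_inv} = count_list w Sigma2_inv"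
proof -
  have "{c \<in> crossings w - {(Sigma1, 1)}. fst c = Sigma2_inv} = Pair Sigma2_inv ` {1..count_list w Sigma2_inv}"
    using crossings_of_letter[of w Sigma2_inv] by auto
  then show ?thesis
    by (simp add: card_image inj_on_def)
qed

lemma crowell_var_Sigma2_inv_iff:
  "crowell_var w e = 2 \<or> crowell_var w e = 4 \<longleftrightarrow> fst (crowell_head w e) = Sigma2_inv"
  using crowell_var_Sigma1_iff[of w e] crowell_var_range[of w e]
  by (cases "fst (crowell_head w e)") auto

lemma card_var_arcs_1_3:
  assumes T: "T \<in> crowell_trees w"
  shows "card (var_arcs w T 1) + card (var_arcs w T 3) = count_list w Sigma1 - 1"
proof -
  have "card (var_arcs w T 1 \<union> var_arcs w T 3) = card (var_arcs w T 1) + card (var_arcs w T 3)"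
    by (rule card_Un_disjoint) (auto simp: finite_var_arcs[OF T], auto simp: var_arcs_def)
  moreover have "var_arcs w T 1 \<union> var_arcs w T 3 = {e \<in> arcs T. fst (crowell_head w e) = Sigma1}"
    by (simp only: var_arcs_def crowell_var_Sigma1_iff[symmetric]) blast
  ultimately show ?thesis
    using crowell_tree_card_head[OF T, of Sigma1] by (simp only: card_nonroot_Sigma1)
qed

lemma card_var_arcs_2_4:
  assumes T: "T \<in> crowell_trees w"
  shows "card (var_arcs w T 2) + card (var_arcs w T 4) = count_list w Sigma2_inv"
proof -
  have "card (var_arcs w T 2 \<union> var_arcs w T 4) = card (var_arcs w T 2) + card (var_arcs w T 4)"
    by (rule card_Un_disjoint) (auto simp: finite_var_arcs[OF T], auto simp: var_arcs_def)
  moreover have "var_arcs w T 2 \<union> var_arcs w T 4 = {e \<in> arcs T. fst (crowell_head w e) = Sigma2_inv}"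
    by (simp only: var_arcs_def crowell_var_Sigma2_inv_iff[symmetric]) blast
  ultimately show ?thesis
    using crowell_tree_card_head[OF T, of Sigma2_inv] by (simp only: card_nonroot_Sigma2_inv)
qed

definition tree_monomial :: "letter list \<Rightarrow> (crossing, crowell_edge) pre_digraph \<Rightarrow> monomial" where
  "tree_monomial w T = (\<Sum>e\<in>arcs T. unit_exp (crowell_var w e))"

lemma lookup_tree_monomial:
  "T \<in> crowell_trees w \<Longrightarrow> Poly_Mapping.lookup (tree_monomial w T) v = card (var_arcs w T v)"
  unfolding tree_monomial_def var_arcs_def
  by (rule lookup_sum_unit_exp) (rule crowell_tree_finite_arcs)

lemma lookup_refined_crowell_poly:
  "Poly_Mapping.lookup (refined_crowell_poly w) m = real (card {T \<in> crowell_trees w. tree_monomial w T = m})"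
  unfolding refined_crowell_poly_def tree_monomial_def
  by (rule lookup_tree_polynomial[OF finite_arcs_crowell_graph crowell_weight_eq])

lemma keys_refined_crowell_poly:
  assumes "m \<in> Poly_Mapping.keys (refined_crowell_poly w)"
  obtains T where "T \<in> crowell_trees w" "tree_monomial w T = m"
proof -
  have "card {T \<in> crowell_trees w. tree_monomial w T = m} \<noteq> 0"
    using assms unfolding in_keys_iff lookup_refined_crowell_poly of_nat_eq_0_iff .
  then have "{T \<in> crowell_trees w. tree_monomial w T = m} \<noteq> {}"
    by (rule contrapos_nn) (simp only: card.empty)
  then show ?thesis using that by blast
qed

lemma bihomogeneous_refined_crowell_poly:
  "bihomogeneous (count_list w Sigma1 - 1) (count_list w Sigma2_inv) (refined_crowell_poly w)"
  unfolding bihomogeneous_def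
proof
  fix m assume "m \<in> Poly_Mapping.keys (refined_crowell_poly w)"
  then obtain T where T: "T \<in> crowell_trees w" "tree_monomial w T = m"
    by (rule keys_refined_crowell_poly)
  show "Poly_Mapping.lookup m 1 + Poly_Mapping.lookup m 3 = count_list w Sigma1 - 1 \<and>
    Poly_Mapping.lookup m 2 + Poly_Mapping.lookup m 4 = count_list w Sigma2_inv"
    unfolding T(2)[symmetric] lookup_tree_monomial[OF T(1)]
    using card_var_arcs_1_3[OF T(1)] card_var_arcs_2_4[OF T(1)] by blast
qed

lemma homogeneous_refined_crowell_poly:
  "homogeneous 4 (count_list w Sigma1 - 1 + count_list w Sigma2_inv) (refined_crowell_poly w)"
  unfolding homogeneous_def
proof
  fix m assume m: "m \<in> Poly_Mapping.keys (refined_crowell_poly w)"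
  then obtain T where T: "T \<in> crowell_trees w" "tree_monomial w T = m"
    by (rule keys_refined_crowell_poly)
  have "Poly_Mapping.keys m \<subseteq> {1..4}"
  proof
    fix v assume "v \<in> Poly_Mapping.keys m"
    then have "card (var_arcs w T v) \<noteq> 0"
      unfolding in_keys_iff T(2)[symmetric] lookup_tree_monomial[OF T(1)] .
    then obtain e where "crowell_var w e = v"
      by (metis (mono_tags, lifting) card.empty empty_Collect_eq var_arcs_def)
    with crowell_var_range[of w e] show "v \<in> {1..4}" by auto
  qed
  moreover have "(\<Sum>i = 1..4. Poly_Mapping.lookup m i) = count_list w Sigma1 - 1 + count_list w Sigma2_inv"
    using bihomogeneous_refined_crowell_poly[of w] m
    unfolding bihomogeneous_def atLeastAtMost_1_4 by fastforce
  ultimately show "Poly_Mapping.keys m \<subseteq> {1..4} \<and>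
    (\<Sum>i = 1..4. Poly_Mapping.lookup m i) = count_list w Sigma1 - 1 + count_list w Sigma2_inv"
    by blast
qed

text \<open>The bidegree determines the exponents of \<open>x\<^sub>1\<close> and
  \<open>x\<^sub>4\<close> from those of \<open>x\<^sub>3\<close> and
  \<open>x\<^sub>2\<close>.\<close>

lemma tree_monomial_eq_bimonomial_iff:
  assumes T: "T \<in> crowell_trees w"
  shows "tree_monomial w T = bimonomial (count_list w Sigma1 - 1) (count_list w Sigma2_inv) i j
    \<longleftrightarrow> card (var_arcs w T 3) = i \<and> card (var_arcs w T 2) = j" (is "_ = ?b \<longleftrightarrow> ?R")
proof
  assume eq: "tree_monomial w T = ?b"
  show ?R
    using lookup_tree_monomial[OF T, of 3] lookup_tree_monomial[OF T, of 2]
    unfolding eq by simp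
next
  assume R: ?R
  show "tree_monomial w T = ?b"
  proof (rule poly_mapping_eqI)
    fix v
    have v: "card (var_arcs w T v) = 0" if "v \<notin> {1, 2, 3, 4}"
    proof -
      have "var_arcs w T v = {}"
        using that crowell_var_range[of w] by (fastforce simp: var_arcs_def)
      then show ?thesis by simp
    qed
    show "Poly_Mapping.lookup (tree_monomial w T) v = Poly_Mapping.lookup ?b v"
      unfolding lookup_tree_monomial[OF T]
      using R v card_var_arcs_1_3[OF T] card_var_arcs_2_4[OF T]
      by (cases "v \<in> {1, 2, 3, 4}") (auto simp: bimonomial_def lookup_add lookup_single)
  qed
qed

section \<open>Bounds for the four corner coefficients\<close>

definition tree_count :: "letter list \<Rightarrow> nat \<Rightarrow> nat \<Rightarrow> nat" where
  "tree_count w i j =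
     card {T \<in> crowell_trees w. card (var_arcs w T 3) = i \<and> card (var_arcs w T 2) = j}"

lemma lookup_refined_crowell_poly_bimonomial:
  "Poly_Mapping.lookup (refined_crowell_poly w)
     (bimonomial (count_list w Sigma1 - 1) (count_list w Sigma2_inv) i j) = real (tree_count w i j)"
proof -
  have "{T \<in> crowell_trees w. tree_monomial w T
      = bimonomial (count_list w Sigma1 - 1) (count_list w Sigma2_inv) i j}
    = {T \<in> crowell_trees w. card (var_arcs w T 3) = i \<and> card (var_arcs w T 2) = j}"
    by (rule Collect_cong) (use tree_monomial_eq_bimonomial_iff in blast)
  then show ?thesis
    by (simp only: lookup_refined_crowell_poly tree_count_def)
qed

lemma finite_crowell_trees: "finite (crowell_trees w)"
  by (rule finite_spanning_out_trees[OF finite_arcs_crowell_graph])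

lemma tree_count_le_1I:
  assumes "\<And>T T'. T \<in> crowell_trees w \<Longrightarrow> T' \<in> crowell_trees w \<Longrightarrow>
    card (var_arcs w T 3) = i \<Longrightarrow> card (var_arcs w T 2) = j \<Longrightarrow>
    card (var_arcs w T' 3) = i \<Longrightarrow> card (var_arcs w T' 2) = j \<Longrightarrow> T = T'"
  shows "tree_count w i j \<le> 1"
proof -
  let ?X = "{T \<in> crowell_trees w. card (var_arcs w T 3) = i \<and> card (var_arcs w T 2) = j}"
  have "finite ?X"
    using finite_crowell_trees by simp
  moreover have "\<forall>T\<in>?X. \<forall>T'\<in>?X. T = T'"
    by (intro ballI, elim CollectE conjE) (rule assms)
  ultimately show ?thesis
    unfolding tree_count_def One_nat_def by (simp only: card_le_Suc0_iff_eq)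
qed

text \<open>All \<open>Sigma2_inv\<close> crossings are entered by \<open>x\<^sub>2\<close> edges,
  so no \<open>x\<^sub>4\<close> is left, and only \<open>x\<^sub>1\<close> and
  \<open>x\<^sub>2\<close> edges are available. Among these the letter of the head determines the
  variable, hence the edge.\<close>

lemma tree_count_no_x3_no_x4:
  "tree_count w 0 (count_list w Sigma2_inv) \<le> 1"
proof (rule tree_count_le_1I)
  fix T T' assume T: "T \<in> crowell_trees w" "T' \<in> crowell_trees w"
    and c: "card (var_arcs w T 3) = 0" "card (var_arcs w T 2) = count_list w Sigma2_inv"
      "card (var_arcs w T' 3) = 0" "card (var_arcs w T' 2) = count_list w Sigma2_inv"
  let ?S = "{e \<in> arcs (crowell_graph w). crowell_var w e \<in> {1, 2}}"
  have sub: "arcs X \<subseteq> ?S" if X: "X \<in> crowell_trees w" "card (var_arcs w X 3) = 0"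
    "card (var_arcs w X 2) = count_list w Sigma2_inv" for X
  proof -
    have "var_arcs w X 3 = {}" "var_arcs w X 4 = {}"
      using X card_var_arcs_2_4[OF X(1)] finite_var_arcs[OF X(1)] by simp_all
    then show ?thesis
      using crowell_tree_arcs_subset[OF X(1)] crowell_var_range[of w] unfolding var_arcs_def by blast
  qed
  have inj: "inj_on (head (crowell_graph w)) ?S"
  proof (rule inj_onI)
    fix e e' assume e: "e \<in> ?S" "e' \<in> ?S" "head (crowell_graph w) e = head (crowell_graph w) e'"
    then have h: "crowell_head w e = crowell_head w e'" by simp
    then have "crowell_var w e = crowell_var w e'"
      using e(1,2) crowell_var_Sigma1_iff[of w e] crowell_var_Sigma1_iff[of w e'] by auto
    then show "e = e'"
      using e h by (intro crowell_head_var_inject) blast+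
  qed
  show "T = T'"
    by (rule spanning_out_trees_unique[OF T sub[OF T(1) c(1,2)] sub[OF T(2) c(3,4)] inj])
qed

text \<open>Without \<open>x\<^sub>1\<close> edges a tree can leave the initial block of
  \<open>Sigma1\<close> only by the word edge into the first \<open>Sigma2_inv\<close>. This is then
  the only \<open>x\<^sub>2\<close> edge, and all other crossings are entered by forced
  \<open>x\<^sub>3\<close> or \<open>x\<^sub>4\<close> edges.\<close>

lemma tree_count_no_x1_one_x2:
  assumes w: "w \<noteq> []" "w ! 0 = Sigma1" and s2: "Sigma2_inv \<in> set w"
  shows "tree_count w (count_list w Sigma1 - 1) 1 \<le> 1"
proof -
  define k where "k = (LEAST i. i < length w \<and> w ! i = Sigma2_inv)"
  have k: "k < length w" "w ! k = Sigma2_inv"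
    using s2 LeastI_ex[of "\<lambda>i. i < length w \<and> w ! i = Sigma2_inv"]
    unfolding k_def in_set_conv_nth by blast+
  have before: "w ! i = Sigma1" if "i < k" for i
    using not_less_Least[of i "\<lambda>i. i < length w \<and> w ! i = Sigma2_inv"] that k(1)
    unfolding k_def[symmetric] by (cases "w ! i") auto
  have "k \<noteq> 0"
    using k w by (cases k) auto
  let ?e = "Word_edge (k - 1)"
  have head_e: "crowell_head w ?e = crossing_at w k"
    using \<open>k \<noteq> 0\<close> k by simp
  have var_e: "crowell_var w ?e = 2"
    using head_e k by (simp add: crowell_var_def del: crowell_head.simps)
  \<comment> \<open>The level edge into crossing \<open>k\<close> is left out because
    \<open>?e\<close> already has that head; this keeps the heads in \<open>?S\<close>
    distinct.\<close>
  let ?S = "insert ?e {e \<in> arcs (crowell_graph w). crowell_var w e = 3 \<or>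
    crowell_var w e = 4 \<and> crowell_head w e \<noteq> crossing_at w k}"
  have e_arc: "?e \<in> arcs (crowell_graph w)"
    using k by auto
  have sub: "arcs T \<subseteq> ?S" if T: "T \<in> crowell_trees w"
    "card (var_arcs w T 3) = count_list w Sigma1 - 1" "card (var_arcs w T 2) = 1" for T
  proof -
    have "var_arcs w T 1 = {}"
      using T card_var_arcs_1_3[OF T(1)] finite_var_arcs[OF T(1)] by simp
    then have v1: "crowell_var w e \<noteq> 1" if "e \<in> arcs T" for e
      using that unfolding var_arcs_def by blast
    let ?A = "crossing_at w ` {..<k}"
    have root: "(Sigma1, 1) \<in> ?A"
      using crossing_at_0[OF w] \<open>k \<noteq> 0\<close> by (intro image_eqI[of _ _ 0]) simp_all
    have "crossing_at w k \<notin> ?A"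
      using k by (auto simp: crossing_at_eq_iff)
    moreover have "crossing_at w k \<in> crossings w"
      using k by simp
    ultimately have "\<not> verts (crowell_graph w) \<subseteq> ?A"
      by (simp only: crowell_graph_simps) blast
    \<comment> \<open>The initial block contains the root but not crossing \<open>k\<close>, so some
      tree edge \<open>a\<close> leaves it.\<close>
    then obtain a where a: "a \<in> arcs T" "crowell_tail w a \<in> ?A" "crowell_head w a \<notin> ?A"
      using spanning_out_tree_closed[OF T(1) root] unfolding crowell_graph_simps by blast
    have "a = ?e"
    proof (cases a)
      case (Level_edge c)
      then have "fst c = Sigma1"
        using a(2) before by auto
      with Level_edge have "crowell_var w a = 1"
        by (simp add: crowell_var_def)
      with v1 a(1) show ?thesis by blast
    next
      case (Word_edge i)
      have i: "i < length w"
        using a(1) crowell_tree_arcs_subset[OF T(1)] Word_edge by auto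
      then have ik: "i < k"
        using a(2) Word_edge k by (auto simp: crossing_at_eq_iff)
      then have "crossing_at w (Suc i) \<notin> ?A"
        using a(3) Word_edge k by simp
      then have "\<not> Suc i < k" by blast
      with ik Word_edge show ?thesis by simp
    qed
    with a have e: "?e \<in> arcs T" by simp
    obtain b where b: "var_arcs w T 2 = {b}"
      using T(3) by (rule card_1_singletonE)
    have "?e \<in> var_arcs w T 2"
      using e var_e by (simp only: var_arcs_def mem_Collect_eq simp_thms)
    then have "?e = b"
      unfolding b by (rule singletonD)
    then have v2: "var_arcs w T 2 = {?e}"
      by (simp only: b)
    show "arcs T \<subseteq> ?S"
    proof
      fix a assume a: "a \<in> arcs T"
      then have a': "a \<in> arcs (crowell_graph w)"
        using crowell_tree_arcs_subset[OF T(1)] by blast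
      have "crowell_var w a \<in> {2, 3, 4}"
        using crowell_var_range[of w a] v1[OF a] by blast
      moreover have "a = ?e" if "crowell_var w a = 2"
        using that a v2 unfolding var_arcs_def by blast
      moreover have "a = ?e" if "crowell_head w a = crossing_at w k"
        using spanning_out_tree_inj_on_head[OF T(1)] a e that head_e
        unfolding crowell_graph_simps by (metis inj_onD)
      ultimately show "a \<in> ?S" using a' by blast
    qed
  qed
  have inj: "inj_on (head (crowell_graph w)) ?S"
  proof (rule inj_onI)
    fix e e' assume e: "e \<in> ?S" "e' \<in> ?S" "head (crowell_graph w) e = head (crowell_graph w) e'"
    then have h: "crowell_head w e = crowell_head w e'" by simp
    have *: "a = ?e" if "a \<in> ?S" "crowell_head w a = crossing_at w k" for a
    proof -
      have "crowell_var w a \<noteq> 3"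
        using that(2) k crowell_var_Sigma1_iff[of w a] by auto
      with that show ?thesis by blast
    qed
    show "e = e'"
    proof (cases "crowell_head w e = crossing_at w k")
      case True
      have "e = ?e"
        by (rule *[OF e(1) True])
      moreover have "e' = ?e"
        by (rule *[OF e(2)]) (simp only: h[symmetric] True)
      ultimately show ?thesis by (simp only:)
    next
      case False
      with e(1,2) h head_e have "crowell_var w e = 3 \<or> crowell_var w e = 4"
        "crowell_var w e' = 3 \<or> crowell_var w e' = 4"
        by (metis (mono_tags, lifting) insertE mem_Collect_eq)+
      then have "crowell_var w e = crowell_var w e'"
        using crowell_var_Sigma1_iff[of w e] crowell_var_Sigma1_iff[of w e'] h by auto
      moreover have "e \<in> arcs (crowell_graph w)" "e' \<in> arcs (crowell_graph w)"
        using e(1,2) e_arc by blast+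
      ultimately show ?thesis
        using h by (intro crowell_head_var_inject)
    qed
  qed
  show ?thesis
  proof (rule tree_count_le_1I)
    fix T T' assume T: "T \<in> crowell_trees w" "T' \<in> crowell_trees w"
      and c: "card (var_arcs w T 3) = count_list w Sigma1 - 1" "card (var_arcs w T 2) = 1"
        "card (var_arcs w T' 3) = count_list w Sigma1 - 1" "card (var_arcs w T' 2) = 1"
    show "T = T'"
      by (rule spanning_out_trees_unique[OF T sub[OF T(1) c(1,2)] sub[OF T(2) c(3,4)] inj])
  qed
qed

text \<open>The witness is the Hamiltonian path obtained from the word cycle by dropping its last
  edge, which returns to the root.\<close>

lemma tree_count_no_x1_no_x4:
  assumes w: "w \<noteq> []" "w ! 0 = Sigma1"
  shows "tree_count w (count_list w Sigma1 - 1) (count_list w Sigma2_inv) \<ge> 1"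
proof -
  let ?G = "crowell_graph w" and ?F = "Word_edge ` {..<length w - 1}"
  let ?T = "?G\<lparr>arcs := ?F\<rparr>"
  have head: "crowell_head w (Word_edge i) = crossing_at w (Suc i)" if "i < length w - 1" for i
    using that by simp
  have T: "?T \<in> crowell_trees w"
  proof (rule restricted_arcs_spanning_out_tree[OF wf_digraph_crowell_graph])
    show "?F \<subseteq> arcs ?G" by auto
    show "inj_on (head ?G) ?F"
      unfolding crowell_graph_simps
      by (rule inj_on_subset[OF inj_on_crowell_head_Word_edge]) auto
    show "(Sigma1, 1) \<in> verts ?G"
      using w crossing_at_in_crossings[of 0 w] by (simp add: crossing_at_0)
    show "head ?G e \<noteq> (Sigma1, 1)" if "e \<in> ?F" for e
    proof -
      obtain i where i: "e = Word_edge i" "i < length w - 1"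
        using \<open>e \<in> ?F\<close> by blast
      then have "crossing_at w (Suc i) \<noteq> crossing_at w 0"
        by (subst crossing_at_eq_iff) auto
      then show ?thesis
        using i head by (simp only: crowell_graph_simps crossing_at_0[OF w] not_False_eq_True)
    qed
    fix S assume S: "(Sigma1, 1) \<in> S" "\<And>e. e \<in> ?F \<Longrightarrow> tail ?G e \<in> S \<Longrightarrow> head ?G e \<in> S"
    have "crossing_at w i \<in> S" if "i < length w" for i
      using that
    proof (induction i)
      case 0
      then show ?case using S(1) crossing_at_0[OF w] by simp
    next
      case (Suc i)
      then have i: "i < length w - 1" "crossing_at w i \<in> S" by simp_all
      then show ?case
        using S(2)[of "Word_edge i"] head[OF i(1)]
        by (simp only: crowell_graph_simps crowell_tail.simps) blast
    qed
    then show "verts ?G \<subseteq> S"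
      unfolding crowell_graph_simps crossing_at_image[symmetric] by blast
  qed
  \<comment> \<open>The bidegree turns the absence of \<open>x\<^sub>1\<close> and
    \<open>x\<^sub>4\<close> into the exact exponents of \<open>x\<^sub>3\<close> and
    \<open>x\<^sub>2\<close>.\<close>
  have "crowell_var w e \<noteq> 1 \<and> crowell_var w e \<noteq> 4" if "e \<in> ?F" for e
    using that by (auto simp: crowell_var_def simp del: crowell_head.simps)
  then have "var_arcs w ?T 1 = {}" "var_arcs w ?T 4 = {}"
    by (auto simp: var_arcs_def)
  then have "card (var_arcs w ?T 3) = count_list w Sigma1 - 1"
    "card (var_arcs w ?T 2) = count_list w Sigma2_inv"
    using card_var_arcs_1_3[OF T] card_var_arcs_2_4[OF T] by simp_all
  with T have "{T \<in> crowell_trees w. card (var_arcs w T 3) = count_list w Sigma1 - 1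
      \<and> card (var_arcs w T 2) = count_list w Sigma2_inv} \<noteq> {}"
    by blast
  then show ?thesis
    using finite_crowell_trees[of w] unfolding tree_count_def
    by (simp add: Suc_le_eq card_gt_0_iff)
qed

text \<open>From \<open>m\<close> the cycle runs down to 1, wraps around to the largest index, and
  runs down again to \<open>k\<close>.\<close>

lemma level_cycle_subset:
  assumes m: "(l, m) \<in> S" "1 \<le> m" "m \<le> count_list w l"
    and closed: "\<And>k. 1 \<le> k \<Longrightarrow> k \<le> count_list w l \<Longrightarrow> (l, k) \<in> S \<Longrightarrow>
      crowell_head w (Level_edge (l, k)) \<in> S"
    and k: "1 \<le> k" "k \<le> count_list w l"
  shows "(l, k) \<in> S"
proof -
  have down: "(l, i) \<in> S" if "(l, j) \<in> S" "1 \<le> i" "i \<le> j" "j \<le> count_list w l" for i j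
    using that(3,1,2,4)
  proof (induction i rule: inc_induct)
    case (step i)
    then have "(l, Suc i) \<in> S" by simp
    then show ?case
      using closed[of "Suc i"] step by simp
  qed
  have "(l, 1) \<in> S"
    using down[OF m(1) _ m(2,3)] by simp
  then have "(l, count_list w l) \<in> S"
    using closed[of 1] m by simp
  then show ?thesis
    using down k by simp
qed

text \<open>Two paths joined by one edge: the \<open>Sigma1\<close> cycle cut at the root, and the
  \<open>Sigma2_inv\<close> cycle cut where \<open>Word_edge i\<close> enters it.\<close>

definition level_tree :: "letter list \<Rightarrow> nat \<Rightarrow> (crossing, crowell_edge) pre_digraph" where
  "level_tree w i = (crowell_graph w)\<lparr>arcs := insert (Word_edge i)
     {e \<in> Level_edge ` crossings w. crowell_head w e \<notin> {(Sigma1, 1), crossing_at w (Suc i)}}\<rparr>"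

text \<open>From the root the cut \<open>Sigma1\<close> cycle is swept first, then
  \<open>Word_edge i\<close> crosses over, then the cut \<open>Sigma2_inv\<close> cycle is swept
  from its entry point.\<close>

lemma level_tree_in_crowell_trees:
  assumes w: "w \<noteq> []" "w ! 0 = Sigma1"
    and i: "Suc i < length w" "w ! i = Sigma1" "w ! Suc i = Sigma2_inv"
  shows "level_tree w i \<in> crowell_trees w"
  unfolding level_tree_def
proof (rule restricted_arcs_spanning_out_tree[OF wf_digraph_crowell_graph])
  let ?G = "crowell_graph w"
  let ?L = "{e \<in> Level_edge ` crossings w. crowell_head w e \<notin> {(Sigma1, 1), crossing_at w (Suc i)}}"
  let ?F = "insert (Word_edge i) ?L"
  have head: "crowell_head w (Word_edge i) = crossing_at w (Suc i)"
    using i by simp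
  show "?F \<subseteq> arcs ?G"
    using i by auto
  show "inj_on (head ?G) ?F"
    unfolding crowell_graph_simps
  proof (subst inj_on_insert, intro conjI)
    show "inj_on (crowell_head w) ?L"
      by (rule inj_on_subset[OF inj_on_crowell_head_Level_edge]) blast
    show "crowell_head w (Word_edge i) \<notin> crowell_head w ` (?L - {Word_edge i})"
      unfolding head by (rule notI, erule imageE) simp
  qed
  show root: "(Sigma1, 1) \<in> verts ?G"
    using w crossing_at_in_crossings[of 0 w] by (simp add: crossing_at_0)
  show "head ?G e \<noteq> (Sigma1, 1)" if "e \<in> ?F" for e
  proof (cases "e = Word_edge i")
    case True
    have "fst (crossing_at w (Suc i)) \<noteq> Sigma1"
      using i by simp
    then show ?thesis
      unfolding crowell_graph_simps True head by force
  next
    case False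
    with that show ?thesis
      unfolding crowell_graph_simps by blast
  qed
  fix S assume S: "(Sigma1, 1) \<in> S" "\<And>e. e \<in> ?F \<Longrightarrow> tail ?G e \<in> S \<Longrightarrow> head ?G e \<in> S"
  \<comment> \<open>The removed level edges lead to the root or to
    \<open>crossing_at w (Suc i)\<close>. Once these lie in \<open>S\<close>, it is closed along
    full cycles and \<open>level_cycle_subset\<close> applies; on the \<open>Sigma1\<close> cycle
    the second case does not occur.\<close>
  have level: "crowell_head w (Level_edge c) \<in> S"
    if "c \<in> crossings w" "c \<in> S" "crowell_head w (Level_edge c) = crossing_at w (Suc i) \<Longrightarrow> crossing_at w (Suc i) \<in> S" for c
  proof (cases "crowell_head w (Level_edge c) \<in> {(Sigma1, 1), crossing_at w (Suc i)}")
    case True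
    then show ?thesis using S(1) that(3) by auto
  next
    case False
    then have "Level_edge c \<in> ?F"
      using that(1) by blast
    from S(2)[OF this] show ?thesis
      using that(2) by (simp only: crowell_graph_simps crowell_tail.simps)
  qed
  have S1: "(Sigma1, k) \<in> S" if k: "1 \<le> k" "k \<le> count_list w Sigma1" for k
  proof (rule level_cycle_subset[OF S(1) _ _ _ k])
    show "1 \<le> count_list w Sigma1"
      using root by (simp add: crossings_def)
    fix k assume "1 \<le> k" "k \<le> count_list w Sigma1" "(Sigma1, k) \<in> S"
    moreover have "crowell_head w (Level_edge (Sigma1, k)) \<noteq> crossing_at w (Suc i)"
      using i by (metis fst_crossing_at fst_conv fst_crowell_head_Level_edge letter.distinct(1))
    ultimately show "crowell_head w (Level_edge (Sigma1, k)) \<in> S"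
      by (intro level) (auto simp: crossings_def)
  qed simp
  have "crossing_at w i \<in> crossings w" "fst (crossing_at w i) = Sigma1"
    using i by simp_all
  then have "crossing_at w i \<in> S"
    using S1 by (cases "crossing_at w i") (simp add: crossings_def)
  then have next_S: "crossing_at w (Suc i) \<in> S"
    using S(2)[of "Word_edge i"] head by (simp only: crowell_graph_simps crowell_tail.simps) blast
  obtain m where m: "crossing_at w (Suc i) = (Sigma2_inv, m)"
    using i(3) fst_crossing_at[of w "Suc i"] by (cases "crossing_at w (Suc i)") simp
  have "(Sigma2_inv, m) \<in> crossings w"
    using i(1) crossing_at_in_crossings m by metis
  then have m_range: "1 \<le> m" "m \<le> count_list w Sigma2_inv"
    by (simp_all add: crossings_def)
  have S2: "(Sigma2_inv, k) \<in> S" if k: "1 \<le> k" "k \<le> count_list w Sigma2_inv" for k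
  proof (rule level_cycle_subset[OF next_S[unfolded m] m_range _ k])
    fix k assume "1 \<le> k" "k \<le> count_list w Sigma2_inv" "(Sigma2_inv, k) \<in> S"
    then show "crowell_head w (Level_edge (Sigma2_inv, k)) \<in> S"
      using next_S by (intro level) (auto simp: crossings_def)
  qed
  show "verts ?G \<subseteq> S"
  proof
    fix c assume "c \<in> verts ?G"
    then show "c \<in> S"
      using S1 S2 by (cases c; cases "fst c") (auto simp: crossings_def)
  qed
qed

lemma level_tree_var_arcs:
  assumes i: "Suc i < length w" "w ! i = Sigma1" "w ! Suc i = Sigma2_inv"
  shows "var_arcs w (level_tree w i) 3 = {}" "var_arcs w (level_tree w i) 2 = {Word_edge i}"
proof -
  have "crowell_var w (Word_edge i) = 2"
    using i by (simp add: crowell_var_def)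
  moreover have "crowell_var w (Level_edge c) \<noteq> 3" "crowell_var w (Level_edge c) \<noteq> 2" for c
    by (simp_all add: crowell_var_def)
  ultimately show "var_arcs w (level_tree w i) 3 = {}"
    "var_arcs w (level_tree w i) 2 = {Word_edge i}"
    by (auto simp: var_arcs_def level_tree_def)
qed

text \<open>Each passage from \<open>Sigma1\<close> to \<open>Sigma2_inv\<close> gives a level tree
  with the same monomial, and its single \<open>x\<^sub>2\<close> edge tells it apart from the
  others.\<close>

lemma tree_count_no_x3_one_x2:
  assumes w: "w \<noteq> []" "w ! 0 = Sigma1" and "i \<noteq> i'"
    and i: "Suc i < length w" "w ! i = Sigma1" "w ! Suc i = Sigma2_inv"
    and i': "Suc i' < length w" "w ! i' = Sigma1" "w ! Suc i' = Sigma2_inv"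
  shows "tree_count w 0 1 \<ge> 2"
proof -
  let ?X = "{T \<in> crowell_trees w. card (var_arcs w T 3) = 0 \<and> card (var_arcs w T 2) = 1}"
  have "level_tree w i \<noteq> level_tree w i'"
    using level_tree_var_arcs(2)[OF i] level_tree_var_arcs(2)[OF i'] \<open>i \<noteq> i'\<close> by force
  then have "card {level_tree w i, level_tree w i'} = 2"
    by simp
  moreover have "{level_tree w i, level_tree w i'} \<subseteq> ?X"
    using level_tree_in_crowell_trees[OF w i] level_tree_in_crowell_trees[OF w i']
    by (simp add: level_tree_var_arcs[OF i] level_tree_var_arcs[OF i'])
  moreover have "finite ?X"
    using finite_crowell_trees by simp
  ultimately show ?thesis
    using card_mono[of ?X "{level_tree w i, level_tree w i'}"] unfolding tree_count_def by linarith
qed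

lemma two_le_count_list:
  fixes w :: "letter list"
  assumes "i < length w" "j < length w" "i \<noteq> j" "w ! i = l" "w ! j = l"
  shows "2 \<le> count_list w l"
proof -
  have "crossing_at w i \<noteq> crossing_at w j"
    using assms by (simp add: crossing_at_eq_iff)
  then have "2 = card {crossing_at w i, crossing_at w j}"
    by simp
  also have "\<dots> \<le> card {c \<in> crossings w. fst c = l}"
    using assms finite_crossings by (intro card_mono) auto
  also have "\<dots> = count_list w l"
    unfolding crossings_of_letter by (simp add: card_image inj_on_def)
  finally show ?thesis .
qed

section \<open>Contradiction from the corner minor\<close>

lemma not_denormalized_lorentzian_two_transitions:
  assumes w: "w \<noteq> []" "w ! 0 = Sigma1" and "i \<noteq> i'"
    and i: "Suc i < length w" "w ! i = Sigma1" "w ! Suc i = Sigma2_inv"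
    and i': "Suc i' < length w" "w ! i' = Sigma1" "w ! Suc i' = Sigma2_inv"
  shows "\<not> denormalized_lorentzian 4 (refined_crowell_poly w)"
proof
  assume L: "denormalized_lorentzian 4 (refined_crowell_poly w)"
  let ?A = "count_list w Sigma1 - 1" and ?B = "count_list w Sigma2_inv"
  have c01: "tree_count w 0 1 \<ge> 2"
    by (rule tree_count_no_x3_one_x2[OF w \<open>i \<noteq> i'\<close> i i'])
  have cAB: "tree_count w ?A ?B \<ge> 1"
    by (rule tree_count_no_x1_no_x4[OF w])
  have "Sigma2_inv \<in> set w"
    using i nth_mem by metis
  then have cA1: "tree_count w ?A 1 \<le> 1"
    by (rule tree_count_no_x1_one_x2[OF w])
  have c0B: "tree_count w 0 ?B \<le> 1"
    by (rule tree_count_no_x3_no_x4)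
  \<comment> \<open>Two passages ensure \<open>0 < ?A\<close> and \<open>1 < ?B\<close>, so the
    rectangle from \<open>(0, 1)\<close> to \<open>(?A, ?B)\<close> has four distinct
    corners.\<close>
  have "2 \<le> count_list w Sigma1" "2 \<le> ?B"
    using two_le_count_list[of i w i' Sigma1] two_le_count_list[of "Suc i" w "Suc i'" Sigma2_inv]
      i i' \<open>i \<noteq> i'\<close> by simp_all
  then have "real (tree_count w 0 1) * real (tree_count w ?A ?B)
      = real (tree_count w ?A 1) * real (tree_count w 0 ?B)"
    using c01 cAB denormalized_lorentzian_bihomogeneous_corner_minor[OF L homogeneous_refined_crowell_poly
      bihomogeneous_refined_crowell_poly, of 0 1 ?A ?B]
    unfolding lookup_refined_crowell_poly_bimonomial by simp
  then have "tree_count w 0 1 * tree_count w ?A ?B = tree_count w ?A 1 * tree_count w 0 ?B"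
    by (simp only: of_nat_mult[symmetric] of_nat_eq_iff)
  moreover have "tree_count w ?A 1 * tree_count w 0 ?B \<le> 1 * 1"
    using cA1 c0B by (rule mult_le_mono)
  moreover have "2 * 1 \<le> tree_count w 0 1 * tree_count w ?A ?B"
    using c01 cAB by (rule mult_le_mono)
  ultimately show False by linarith
qed

theorem proposition2p32:
  fixes n :: nat and p q :: "nat \<Rightarrow> nat"
  assumes "n \<ge> 1"
    and "\<And>i. i \<in> {1..n} \<Longrightarrow> p i > 0 \<and> q i > 0"
    and "n \<noteq> 1"
  shows "\<not> denormalized_lorentzian 4 (refined_crowell_poly (alternating_word n p q))"
proof -
  have "p 1 > 0" "q 1 > 0" "p 2 > 0" "q 2 > 0"
    using assms(1,3) assms(2)[of 1] assms(2)[of 2] by simp_all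
  then obtain a b c d where pq: "p 1 = Suc a" "q 1 = Suc b" "p 2 = Suc c" "q 2 = Suc d"
    using gr0_implies_Suc by meson
  \<comment> \<open>Since \<open>n \<ge> 2\<close>, the first two pairs of blocks can be split off;
    they already contain two passages.\<close>
  have "[1..<Suc n] = 1 # 2 # [3..<Suc n]"
    using assms(1,3) by (simp add: upt_conv_Cons numeral_eq_Suc)
  then obtain u where "alternating_word n p q =
    replicate (Suc a) Sigma1 @ replicate (Suc b) Sigma2_inv @
    replicate (Suc c) Sigma1 @ replicate (Suc d) Sigma2_inv @ u"
    by (simp add: alternating_word_def pq del: One_nat_def upt_Suc replicate_Suc)
  then show ?thesis
    \<comment> \<open>The passages start at the last letters of the first two \<open>Sigma1\<close>
      blocks. Counted from 0 these positions are \<open>p 1 - 1 = a\<close> and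
      \<open>p 1 + q 1 + p 2 - 1 = a + b + c + 2\<close>.\<close>
    by (intro not_denormalized_lorentzian_two_transitions[of _ a "a + b + c + 2"])
      (auto simp: nth_append nth_Cons' simp del: replicate_Suc)
qed

end
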